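(* Let $\mathbf n=(n_1,\ldots,n_k)\in\mathbb N^k$ be such that $n_i\ge2$ and $n_j\ge2$ for some $i,j\in\{1,\ldots,k\}$, $i\ne j$. Then, for each $t\in(0,1)$, there exists an uncountable family $\{T^{(\omega)}(t)\}_{\omega\in\Omega}$ of pure elements in the regular polyball (each $T^{(\omega)}(t)$ lying in $\mathbf B_{\mathbf n}(\mathcal H_\omega)$ for some Hilbert space $\mathcal H_\omega$) with the following properties: (i) $T^{(\omega)}(t)$ is not unitarily equivalent to $T^{(\sigma)}(t)$ for any $\omega,\sigma\in\Omega$, $\omega\ne\sigma$. (ii) $\mathrm{rank}[T^{(\omega)}(t)]=1$ and $\mathrm{curv}[T^{(\omega)}(t)]=t$ for all $\omega\in\Omega$.
   Context: All Hilbert spaces are complex; $\mathbb N=\{1,2,\ldots\}$. For $X_i=(X_{i,1},\ldots,X_{i,n_i})\in B(\mathcal H)^{n_i}$ let $\Phi_{X_i}(Y)=\sum_{j=1}^{n_i}X_{i,j}YX_{i,j}^*$ for $Y\in B(\mathcal H)$. The regular polyball $\mathbf B_{\mathbf n}(\mathcal H)$ is the set of all $\mathbf X=(X_1,\ldots,X_k)$ with $X_i\in B(\mathcal H)^{n_i}$ such that every entry of $X_s$ commutes with every entry of $X_t$ whenever $s\ne t$ (entries of the same $X_s$ need not commute) and $(id-\Phi_{X_1})^{p_1}\circ\cdots\circ(id-\Phi_{X_k})^{p_k}(I)\ge0$ for all $(p_1,\ldots,p_k)\in\{0,1\}^k$. Put $\mathbf\Delta_{\mathbf X}=(id-\Phi_{X_1})\circ\cdots\circ(id-\Phi_{X_k})$.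 For $\mathbf T\in\mathbf B_{\mathbf n}(\mathcal H)$, $\mathrm{rank}(\mathbf T):=\mathrm{rank}[\mathbf\Delta_{\mathbf T}(I)]$; $\mathbf T$ is pure if $\Phi_{T_i}^{q}(I)\to0$ weakly as $q\to\infty$ for each $i$. Tuples $\mathbf T\in\mathbf B_{\mathbf n}(\mathcal H)$, $\mathbf T'\in\mathbf B_{\mathbf n}(\mathcal H')$ are unitarily equivalent if there is a unitary $U:\mathcal H\to\mathcal H'$ with $UT_{i,j}=T'_{i,j}U$ for all $i,j$. Put $\mathcal D_{\mathbf T}=\overline{\mathbf\Delta_{\mathbf T}(I)\mathcal H}$. $F^2(H_{n_i})=\mathbb C1\oplus\bigoplus_{p\ge1}H_{n_i}^{\otimes p}$ is the full Fock space of an $n_i$-dimensional Hilbert space $H_{n_i}$ with orthonormal basis $e^i_1,\ldots,e^i_{n_i}$. $\mathbb F_{n_i}^+$ is the free unital semigroup on $n_i$ generators $g_1^i,\ldots,g_{n_i}^i$ with length $|\cdot|$; for $\alpha=g^i_{j_1}\cdots g^i_{j_p}$ put $e^i_\alpha=e^i_{j_1}\otimes\cdots\otimes e^i_{j_p}$ and $T_{i,\alpha}=T_{i,j_1}\cdots T_{i,j_p}$, while for the neutral element $e^i_\alpha=1$ and $T_{i,\alpha}=I$. The Berezin kernel of $\mathbf T$ is $\mathbf K_{\mathbf T}:\mathcal H\to\bigotimes_{i=1}^kF^2(H_{n_i})\otimes\mathcal D_{\mathbf T}$, $$\mathbf K_{\mathbf T}h=\sum_{\beta_i\in\mathbb F_{n_i}^+,\,i=1,\ldots,k}e^1_{\beta_1}\otimes\cdots\otimes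 e^k_{\beta_k}\otimes\mathbf\Delta_{\mathbf T}(I)^{1/2}T_{1,\beta_1}^*\cdots T_{k,\beta_k}^*h.$$ $P^{(i)}_q$ is the orthogonal projection of $F^2(H_{n_i})$ onto the span of all $e^i_\alpha$ with $|\alpha|=q$. For $\mathbf T$ with trace class $\mathbf\Delta_{\mathbf T}(I)$, $$\mathrm{curv}(\mathbf T):=\lim_{m\to\infty}\frac1{\binom{m+k}{k}}\sum_{\substack{q_1\ge0,\ldots,q_k\ge0\\ q_1+\cdots+q_k\le m}}\frac{\mathrm{trace}\left[\mathbf K_{\mathbf T}^*(P^{(1)}_{q_1}\otimes\cdots\otimes P^{(k)}_{q_k}\otimes I_{\mathcal D_{\mathbf T}})\mathbf K_{\mathbf T}\right]}{\mathrm{trace}\left[P^{(1)}_{q_1}\otimes\cdots\otimes P^{(k)}_{q_k}\right]}$$ (this limit exists). *)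

theory Defs
  imports "HOL-Analysis.Analysis"
begin

section \<open>Complex Hilbert spaces\<close>

text \<open>The inner product is linear in the first argument.  The real structure of a complex inner
  product space (in particular norm, topology and completeness) is that of \<^class>\<open>real_inner\<close>.\<close>

class complex_vector = real_vector +
  fixes scaleC :: "complex \<Rightarrow> 'a \<Rightarrow> 'a"  (infixr "*\<^sub>C" 75)
  assumes scaleC_add_right: "a *\<^sub>C (x + y) = a *\<^sub>C x + a *\<^sub>C y"
    and scaleC_add_left: "(a + b) *\<^sub>C x = a *\<^sub>C x + b *\<^sub>C x"
    and scaleC_scaleC: "a *\<^sub>C (b *\<^sub>C x) = (a * b) *\<^sub>C x"
    and scaleC_one: "1 *\<^sub>C x = x"
    and scaleR_scaleC: "scaleR r x = complex_of_real r *\<^sub>C x"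

class complex_inner = complex_vector + real_inner +
  fixes cinner :: "'a \<Rightarrow> 'a \<Rightarrow> complex"
  assumes cinner_commute: "cinner x y = cnj (cinner y x)"
    and cinner_add_left: "cinner (x + y) z = cinner x z + cinner y z"
    and cinner_scaleC_left: "cinner (c *\<^sub>C x) y = c * cinner x y"
    and inner_eq_Re_cinner: "inner x y = Re (cinner x y)"

class chilbert_space = complex_inner + complete_space

global_interpretation complex_vector: vector_space "scaleC :: complex \<Rightarrow> 'a \<Rightarrow> 'a::complex_vector"
  by unfold_locales (rule scaleC_add_right scaleC_add_left scaleC_scaleC scaleC_one)+

lemma Im_cinner: "Im (cinner x y) = - inner (\<i> *\<^sub>C x) (y::'a::complex_inner)"
  by (simp add: inner_eq_Re_cinner cinner_scaleC_left)

lemma cinner_self: "cinner x x = complex_of_real ((norm (x::'a::complex_inner))\<^sup>2)"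
proof -
  have "Im (cinner x x) = 0"
    using arg_cong[OF cinner_commute[of x x], of Im] by simp
  then show ?thesis
    by (simp add: complex_eq_iff power2_norm_eq_inner inner_eq_Re_cinner)
qed

lemma norm_scaleC: "norm (c *\<^sub>C (x::'a::complex_inner)) = norm c * norm x"
proof -
  have "cinner (c *\<^sub>C x) (c *\<^sub>C x) = c * cnj c * cinner x x"
    by (metis cinner_commute cinner_scaleC_left complex_cnj_mult mult.assoc)
  then have "complex_of_real ((norm (c *\<^sub>C x))\<^sup>2) = complex_of_real ((norm c * norm x)\<^sup>2)"
    by (simp add: cinner_self complex_norm_square[symmetric] power_mult_distrib)
  then show ?thesis
    by (simp only: of_real_eq_iff) simp
qed

lemma norm_cinner_le: "norm (cinner x y) \<le> 2 * (norm x * norm (y::'a::complex_inner))"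
proof -
  have "\<bar>Re (cinner x y)\<bar> \<le> norm x * norm y"
    by (metis Cauchy_Schwarz_ineq2 inner_eq_Re_cinner)
  moreover have "\<bar>Im (cinner x y)\<bar> \<le> norm x * norm y"
    using Cauchy_Schwarz_ineq2[of "\<i> *\<^sub>C x" y] by (simp add: Im_cinner norm_scaleC)
  ultimately show ?thesis
    using cmod_le[of "cinner x y"] by linarith
qed

instantiation complex :: chilbert_space
begin

definition scaleC_complex :: "complex \<Rightarrow> complex \<Rightarrow> complex" where "scaleC_complex = (*)"

definition cinner_complex :: "complex \<Rightarrow> complex \<Rightarrow> complex" where "cinner_complex x y = x * cnj y"

instance
  by standard
    (auto simp: scaleC_complex_def cinner_complex_def algebra_simps inner_complex_def scaleR_conv_of_real)

end


section \<open>Square summable families\<close>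

typedef (overloaded) ('i, 'a) ell2 =
  "{f :: 'i \<Rightarrow> 'a::complex_inner. (\<lambda>i. (norm (f i))\<^sup>2) summable_on UNIV}"
  by (rule exI[of _ "\<lambda>_. 0"]) simp

setup_lifting type_definition_ell2

lemma Rep_ell2_summable: "(\<lambda>i. (norm (Rep_ell2 f i))\<^sup>2) summable_on UNIV"
  using Rep_ell2[of f] by simp

lemma ell2_add_aux:
  fixes f g :: "'i \<Rightarrow> 'a::complex_inner"
  assumes "(\<lambda>i. (norm (f i))\<^sup>2) summable_on UNIV" "(\<lambda>i. (norm (g i))\<^sup>2) summable_on UNIV"
  shows "(\<lambda>i. (norm (f i + g i))\<^sup>2) summable_on UNIV"
proof (rule summable_on_comparison_test)
  show "(\<lambda>i. 2 * (norm (f i))\<^sup>2 + 2 * (norm (g i))\<^sup>2) summable_on UNIV"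
    by (intro summable_on_add summable_on_cmult_right assms)
  fix i
  have "(norm (f i + g i))\<^sup>2 \<le> (norm (f i) + norm (g i))\<^sup>2"
    by (intro power_mono norm_triangle_ineq) simp
  also have "\<dots> \<le> 2 * (norm (f i))\<^sup>2 + 2 * (norm (g i))\<^sup>2"
    using zero_le_power2[of "norm (f i) - norm (g i)"] by (simp add: power2_eq_square algebra_simps)
  finally show "(norm (f i + g i))\<^sup>2 \<le> 2 * (norm (f i))\<^sup>2 + 2 * (norm (g i))\<^sup>2" .
qed simp

lemma ell2_scale_aux:
  fixes f :: "'i \<Rightarrow> 'a::complex_inner"
  assumes "(\<lambda>i. (norm (f i))\<^sup>2) summable_on UNIV"
  shows "(\<lambda>i. (norm (c *\<^sub>C f i))\<^sup>2) summable_on UNIV"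
  using summable_on_cmult_right[OF assms, of "(norm c)\<^sup>2"] by (simp add: norm_scaleC power_mult_distrib)

lemma ell2_scaleR_aux:
  fixes f :: "'i \<Rightarrow> 'a::complex_inner"
  assumes "(\<lambda>i. (norm (f i))\<^sup>2) summable_on UNIV"
  shows "(\<lambda>i. (norm (r *\<^sub>R f i))\<^sup>2) summable_on UNIV"
  using ell2_scale_aux[OF assms, of "complex_of_real r"] by (simp add: scaleR_scaleC)

lemma ell2_diff_aux:
  fixes f g :: "'i \<Rightarrow> 'a::complex_inner"
  assumes "(\<lambda>i. (norm (f i))\<^sup>2) summable_on UNIV" "(\<lambda>i. (norm (g i))\<^sup>2) summable_on UNIV"
  shows "(\<lambda>i. (norm (f i - g i))\<^sup>2) summable_on UNIV"
  using ell2_add_aux[of f "\<lambda>i. - g i"] assms by simp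

lemma ell2_cinner_summable:
  "(\<lambda>i. cinner (Rep_ell2 f i) (Rep_ell2 g i)) summable_on UNIV"
proof (rule abs_summable_summable, rule summable_on_comparison_test)
  show "(\<lambda>i. (norm (Rep_ell2 f i))\<^sup>2 + (norm (Rep_ell2 g i))\<^sup>2) summable_on UNIV"
    by (intro summable_on_add Rep_ell2_summable)
  fix i
  show "norm (cinner (Rep_ell2 f i) (Rep_ell2 g i)) \<le> (norm (Rep_ell2 f i))\<^sup>2 + (norm (Rep_ell2 g i))\<^sup>2"
    using norm_cinner_le[of "Rep_ell2 f i" "Rep_ell2 g i"]
      zero_le_power2[of "norm (Rep_ell2 f i) - norm (Rep_ell2 g i)"]
    by (simp add: power2_eq_square algebra_simps)
qed simp

instantiation ell2 :: (type, complex_inner) complex_vector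
begin

lift_definition zero_ell2 :: "('a, 'b) ell2" is "\<lambda>_. 0" by simp

lift_definition plus_ell2 :: "('a, 'b) ell2 \<Rightarrow> ('a, 'b) ell2 \<Rightarrow> ('a, 'b) ell2"
  is "\<lambda>f g i. f i + g i" by (rule ell2_add_aux)

lift_definition minus_ell2 :: "('a, 'b) ell2 \<Rightarrow> ('a, 'b) ell2 \<Rightarrow> ('a, 'b) ell2"
  is "\<lambda>f g i. f i - g i" by (rule ell2_diff_aux)

lift_definition uminus_ell2 :: "('a, 'b) ell2 \<Rightarrow> ('a, 'b) ell2"
  is "\<lambda>f i. - f i" by simp

lift_definition scaleC_ell2 :: "complex \<Rightarrow> ('a, 'b) ell2 \<Rightarrow> ('a, 'b) ell2"
  is "\<lambda>c f i. c *\<^sub>C f i" by (rule ell2_scale_aux)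

lift_definition scaleR_ell2 :: "real \<Rightarrow> ('a, 'b) ell2 \<Rightarrow> ('a, 'b) ell2"
  is "\<lambda>r f i. r *\<^sub>R f i" by (rule ell2_scaleR_aux)

instance
proof
  fix f g h :: "('a, 'b) ell2" and c d :: complex and r s :: real
  show "f + g + h = f + (g + h)" by transfer (simp add: add.assoc)
  show "f + g = g + f" by transfer (simp add: add.commute)
  show "0 + f = f" by transfer simp
  show "- f + f = 0" by transfer simp
  show "f - g = f + - g" by transfer simp
  show "r *\<^sub>R (f + g) = r *\<^sub>R f + r *\<^sub>R g" by transfer (simp add: scaleR_add_right)
  show "(r + s) *\<^sub>R f = r *\<^sub>R f + s *\<^sub>R f" by transfer (simp add: scaleR_add_left)
  show "r *\<^sub>R s *\<^sub>R f = (r * s) *\<^sub>R f" by transfer simp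
  show "1 *\<^sub>R f = f" by transfer simp
  show "c *\<^sub>C (f + g) = c *\<^sub>C f + c *\<^sub>C g" by transfer (simp add: scaleC_add_right)
  show "(c + d) *\<^sub>C f = c *\<^sub>C f + d *\<^sub>C f" by transfer (simp add: scaleC_add_left)
  show "c *\<^sub>C d *\<^sub>C f = (c * d) *\<^sub>C f" by transfer (simp add: scaleC_scaleC)
  show "1 *\<^sub>C f = f" by transfer (simp add: scaleC_one)
  show "r *\<^sub>R f = complex_of_real r *\<^sub>C f" by transfer (simp add: scaleR_scaleC)
qed

end

instantiation ell2 :: (type, complex_inner) complex_inner
begin

definition cinner_ell2 :: "('a, 'b) ell2 \<Rightarrow> ('a, 'b) ell2 \<Rightarrow> complex" where
  "cinner_ell2 f g = (\<Sum>\<^sub>\<infinity>i. cinner (Rep_ell2 f i) (Rep_ell2 g i))"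

definition inner_ell2 :: "('a, 'b) ell2 \<Rightarrow> ('a, 'b) ell2 \<Rightarrow> real" where
  "inner_ell2 f g = Re (cinner f g)"

definition norm_ell2 :: "('a, 'b) ell2 \<Rightarrow> real" where
  "norm_ell2 f = sqrt (inner f f)"

definition sgn_ell2 :: "('a, 'b) ell2 \<Rightarrow> ('a, 'b) ell2" where
  "sgn_ell2 f = f /\<^sub>R norm f"

definition dist_ell2 :: "('a, 'b) ell2 \<Rightarrow> ('a, 'b) ell2 \<Rightarrow> real" where
  "dist_ell2 f g = norm (f - g)"

definition uniformity_ell2 :: "(('a, 'b) ell2 \<times> ('a, 'b) ell2) filter" where
  "uniformity_ell2 = (INF e\<in>{0 <..}. principal {(x, y). dist x y < e})"

definition open_ell2 :: "('a, 'b) ell2 set \<Rightarrow> bool" where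
  "open_ell2 S = (\<forall>x\<in>S. \<forall>\<^sub>F (x', y) in uniformity. x' = x \<longrightarrow> y \<in> S)"

instance
proof
  fix f g h :: "('a, 'b) ell2" and r :: real
  show "sgn f = f /\<^sub>R norm f" by (rule sgn_ell2_def)
  show "dist f g = norm (f - g)" by (rule dist_ell2_def)
  show "uniformity = (INF e\<in>{0 <..}. principal {(x::('a, 'b) ell2, y). dist x y < e})"
    by (rule uniformity_ell2_def)
  show "open S = (\<forall>x\<in>S. \<forall>\<^sub>F (x', y) in uniformity. x' = x \<longrightarrow> y \<in> S)" for S :: "('a, 'b) ell2 set"
    by (rule open_ell2_def)
  show comm: "cinner x y = cnj (cinner y x)" for x y :: "('a, 'b) ell2"
    unfolding cinner_ell2_def infsum_cnj[symmetric] by (intro infsum_cong cinner_commute)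
  show add: "cinner (x + y) z = cinner x z + cinner y z" for x y z :: "('a, 'b) ell2"
    unfolding cinner_ell2_def plus_ell2.rep_eq cinner_add_left
    by (intro infsum_add ell2_cinner_summable)
  show scale: "cinner (a *\<^sub>C x) y = a * cinner x y" for a and x y :: "('a, 'b) ell2"
    unfolding cinner_ell2_def scaleC_ell2.rep_eq cinner_scaleC_left
    by (intro infsum_cmult_right ell2_cinner_summable)
  show "inner f g = Re (cinner f g)" by (rule inner_ell2_def)
  show "inner f g = inner g f"
    unfolding inner_ell2_def by (subst comm) simp
  show "inner (f + g) h = inner f h + inner g h"
    by (simp add: inner_ell2_def add)
  show "inner (r *\<^sub>R f) g = r * inner f g"
    unfolding inner_ell2_def scaleR_scaleC scale by simp
  have self: "inner f f = (\<Sum>\<^sub>\<infinity>i. (norm (Rep_ell2 f i))\<^sup>2)"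
    unfolding inner_ell2_def cinner_ell2_def infsum_Re[OF ell2_cinner_summable, symmetric]
    by (simp add: cinner_self)
  show "0 \<le> inner f f"
    unfolding self by (intro infsum_nonneg) simp
  show "inner f f = 0 \<longleftrightarrow> f = 0"
  proof
    assume "inner f f = 0"
    then have "(norm (Rep_ell2 f i))\<^sup>2 = 0" for i
      unfolding self by (intro nonneg_infsum_le_0D[OF _ Rep_ell2_summable]) auto
    then show "f = 0" by transfer auto
  next
    assume "f = 0"
    then show "inner f f = 0" unfolding self by (simp add: zero_ell2.rep_eq)
  qed
  show "norm f = sqrt (inner f f)" by (rule norm_ell2_def)
qed

end

lemma norm_ell2_square: "(norm f)\<^sup>2 = (\<Sum>\<^sub>\<infinity>i. (norm (Rep_ell2 f i))\<^sup>2)"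
  unfolding power2_norm_eq_inner[of f] inner_ell2_def cinner_ell2_def
    infsum_Re[OF ell2_cinner_summable, symmetric]
  by (simp add: cinner_self)

lemma norm_ell2_finite_le: "finite F \<Longrightarrow> (\<Sum>i\<in>F. (norm (Rep_ell2 f i))\<^sup>2) \<le> (norm f)\<^sup>2"
  unfolding norm_ell2_square by (intro finite_sum_le_infsum Rep_ell2_summable) auto

lemma norm_Rep_ell2_le: "norm (Rep_ell2 f i) \<le> norm f"
  by (rule power2_le_imp_le) (use norm_ell2_finite_le[of "{i}" f] in auto)

instance ell2 :: (type, chilbert_space) chilbert_space
proof
  fix X :: "nat \<Rightarrow> ('a, 'b) ell2"
  assume X: "Cauchy X"
  have "Cauchy (\<lambda>n. Rep_ell2 (X n) i)" for i
  proof (rule CauchyI)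
    fix e :: real assume "e > 0"
    then obtain M where M: "norm (X m - X n) < e" if "m \<ge> M" "n \<ge> M" for m n
      using CauchyD[OF X] by blast
    have "norm (Rep_ell2 (X m) i - Rep_ell2 (X n) i) < e" if "m \<ge> M" "n \<ge> M" for m n
      using norm_Rep_ell2_le[of "X m - X n" i] M[OF that] by (simp add: minus_ell2.rep_eq)
    then show "\<exists>M. \<forall>m\<ge>M. \<forall>n\<ge>M. norm (Rep_ell2 (X m) i - Rep_ell2 (X n) i) < e" by blast
  qed
  then have "\<forall>i. \<exists>l. (\<lambda>n. Rep_ell2 (X n) i) \<longlonglongrightarrow> l"
    by (simp add: Cauchy_convergent_iff convergent_def)
  then obtain g where g: "(\<lambda>n. Rep_ell2 (X n) i) \<longlonglongrightarrow> g i" for i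
    unfolding choice_iff by blast
  have fin: "(\<Sum>i\<in>F. (norm (Rep_ell2 (X m) i - g i))\<^sup>2) \<le> e\<^sup>2"
    if F: "finite F" and M: "\<And>n. n \<ge> M \<Longrightarrow> norm (X m - X n) < e" for F m M and e :: real
  proof (rule LIMSEQ_le_const2)
    show "(\<lambda>n. \<Sum>i\<in>F. (norm (Rep_ell2 (X m) i - Rep_ell2 (X n) i))\<^sup>2)
        \<longlonglongrightarrow> (\<Sum>i\<in>F. (norm (Rep_ell2 (X m) i - g i))\<^sup>2)"
      by (intro tendsto_intros g)
    have "(\<Sum>i\<in>F. (norm (Rep_ell2 (X m) i - Rep_ell2 (X n) i))\<^sup>2) \<le> e\<^sup>2" if "n \<ge> M" for n
    proof -
      have "(\<Sum>i\<in>F. (norm (Rep_ell2 (X m) i - Rep_ell2 (X n) i))\<^sup>2) \<le> (norm (X m - X n))\<^sup>2"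
        using norm_ell2_finite_le[OF F, of "X m - X n"] by (simp add: minus_ell2.rep_eq)
      also have "\<dots> \<le> e\<^sup>2"
        using M[OF that] by (intro power_mono) auto
      finally show ?thesis .
    qed
    then show "\<exists>N. \<forall>n\<ge>N. (\<Sum>i\<in>F. (norm (Rep_ell2 (X m) i - Rep_ell2 (X n) i))\<^sup>2) \<le> e\<^sup>2"
      by blast
  qed
  have summ: "(\<lambda>i. (norm (Rep_ell2 (X m) i - g i))\<^sup>2) summable_on UNIV"
    if M: "\<And>n. n \<ge> M \<Longrightarrow> norm (X m - X n) < e" for m M and e :: real
    by (rule nonneg_bounded_partial_sums_imp_summable_on[where C = "e\<^sup>2"])
      (auto simp: eventually_finite_subsets_at_top intro!: exI[of _ "{}"] fin[OF _ M])
  obtain M where "norm (X m - X n) < 1" if "m \<ge> M" "n \<ge> M" for m n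
    using CauchyD[OF X, of 1] by auto
  then have "(\<lambda>i. (norm (Rep_ell2 (X M) i - g i))\<^sup>2) summable_on UNIV"
    by (intro summ[of M _ 1]) auto
  from ell2_diff_aux[OF Rep_ell2_summable[of "X M"] this]
  have "(\<lambda>i. (norm (g i))\<^sup>2) summable_on UNIV" by simp
  then obtain G where G: "Rep_ell2 G = g"
    by (metis Abs_ell2_inverse mem_Collect_eq)
  have "X \<longlonglongrightarrow> G"
  proof (rule LIMSEQ_I)
    fix e :: real assume e: "e > 0"
    then obtain M where M: "norm (X m - X n) < e / 2" if "m \<ge> M" "n \<ge> M" for m n
      using CauchyD[OF X, of "e / 2"] by auto
    have "norm (X m - G) < e" if m: "m \<ge> M" for m
    proof -
      have "(norm (X m - G))\<^sup>2 \<le> (e / 2)\<^sup>2"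
        unfolding norm_ell2_square minus_ell2.rep_eq G
        by (intro infsum_le_finite_sums fin[of _ M] summ[of M _ "e / 2"] M m)
      then have "norm (X m - G) \<le> e / 2"
        by (rule power2_le_imp_le) (use e in simp)
      then show ?thesis using e by simp
    qed
    then show "\<exists>no. \<forall>n\<ge>no. norm (X n - G) < e" by blast
  qed
  then show "convergent X" by (auto simp: convergent_def)
qed

lift_definition ell2_single :: "'i \<Rightarrow> 'a \<Rightarrow> ('i, 'a::complex_inner) ell2"
  is "\<lambda>i x j. if j = i then x else 0"
  by (rule finite_nonzero_values_imp_summable_on) (auto intro!: finite_subset[of _ "{i}" for i])

lift_definition ell2_restrict :: "'i set \<Rightarrow> ('i, 'a) ell2 \<Rightarrow> ('i, 'a::complex_inner) ell2"
  is "\<lambda>A f i. if i \<in> A then f i else 0"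
  by (rule summable_on_comparison_test) auto


section \<open>Operators\<close>

text \<open>A Hilbert space is represented by a closed complex subspace of a type of class
  \<^class>\<open>chilbert_space\<close>, so that it can vary inside a formula.  An operator on it is a HOL function
  of which only the values on the subspace matter.  Up to isomorphism, the closed subspaces of
  \<^typ>\<open>('i, complex) ell2\<close> with \<open>'i\<close> infinite include all separable Hilbert spaces.\<close>

definition hilbert_subspace :: "'a::chilbert_space set \<Rightarrow> bool" where
  "hilbert_subspace H \<longleftrightarrow> complex_vector.subspace H \<and> closed H"

definition bounded_op :: "'a::chilbert_space set \<Rightarrow> 'b::chilbert_space set \<Rightarrow> ('a \<Rightarrow> 'b) \<Rightarrow> bool" where
  "bounded_op H K A \<longleftrightarrow>
     (\<forall>x\<in>H. A x \<in> K) \<and>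
     (\<forall>x\<in>H. \<forall>y\<in>H. A (x + y) = A x + A y) \<and>
     (\<forall>c. \<forall>x\<in>H. A (c *\<^sub>C x) = c *\<^sub>C A x) \<and>
     (\<exists>C. \<forall>x\<in>H. norm (A x) \<le> C * norm x)"

definition adj_op :: "'a::chilbert_space set \<Rightarrow> 'b::chilbert_space set \<Rightarrow> ('a \<Rightarrow> 'b) \<Rightarrow> 'b \<Rightarrow> 'a" where
  "adj_op H K A y = (if y \<in> K then THE z. z \<in> H \<and> (\<forall>x\<in>H. cinner (A x) y = cinner x z) else 0)"

definition positive_op :: "'a::chilbert_space set \<Rightarrow> ('a \<Rightarrow> 'a) \<Rightarrow> bool" where
  "positive_op H A \<longleftrightarrow> bounded_op H H A \<and> (\<forall>x\<in>H. cinner (A x) x \<in> \<real>\<^sub>\<ge>\<^sub>0)"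

text \<open>The root is normalised to vanish off the space, which makes it unique as a HOL function.\<close>

definition sqrt_op :: "'a::chilbert_space set \<Rightarrow> ('a \<Rightarrow> 'a) \<Rightarrow> 'a \<Rightarrow> 'a" where
  "sqrt_op H A = (THE S. positive_op H S \<and> (\<forall>x\<in>H. S (S x) = A x) \<and> (\<forall>x. x \<notin> H \<longrightarrow> S x = 0))"

definition rank_op :: "'a::chilbert_space set \<Rightarrow> ('a \<Rightarrow> 'a) \<Rightarrow> enat" where
  "rank_op H A =
     (if \<exists>B. finite B \<and> A ` H \<subseteq> complex_vector.span B then enat (complex_vector.dim (A ` H)) else \<infinity>)"

definition orthonormal_basis :: "'a::chilbert_space set \<Rightarrow> 'a set \<Rightarrow> bool" where
  "orthonormal_basis H E \<longleftrightarrow>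
     E \<subseteq> H \<and> (\<forall>x\<in>E. \<forall>y\<in>E. cinner x y = (if x = y then 1 else 0)) \<and>
     closure (complex_vector.span E) = H"

definition trace_op :: "'a::chilbert_space set \<Rightarrow> ('a \<Rightarrow> 'a) \<Rightarrow> complex" where
  "trace_op H A =
     (THE c. \<forall>E. orthonormal_basis H E \<longrightarrow> ((\<lambda>e. cinner (A e) e) has_sum c) E)"

definition unitary_op :: "'a::chilbert_space set \<Rightarrow> 'b::chilbert_space set \<Rightarrow> ('a \<Rightarrow> 'b) \<Rightarrow> bool" where
  "unitary_op H K U \<longleftrightarrow>
     bounded_op H K U \<and> U ` H = K \<and> (\<forall>x\<in>H. \<forall>y\<in>H. cinner (U x) (U y) = cinner x y)"


section \<open>The regular polyball\<close>

text \<open>Throughout, \<open>k\<close> and \<open>n\<close> encode the tuple \<open>(n 1, \<dots>, n k)\<close>, and \<open>X i j\<close> is the \<open>j\<close>-th entry of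
  the \<open>i\<close>-th component of a tuple \<open>X\<close>; only the values with \<open>i \<in> {1..k}\<close> and \<open>j \<in> {1..n i}\<close> matter.\<close>

type_synonym 'a op_tuple = "nat \<Rightarrow> nat \<Rightarrow> 'a \<Rightarrow> 'a"

definition Phi ::
    "'a::chilbert_space set \<Rightarrow> nat \<Rightarrow> (nat \<Rightarrow> 'a \<Rightarrow> 'a) \<Rightarrow> ('a \<Rightarrow> 'a) \<Rightarrow> 'a \<Rightarrow> 'a" where
  "Phi H m Z Y = (\<lambda>h. \<Sum>j=1..m. Z j (Y (adj_op H H (Z j) h)))"

definition id_minus_Phi ::
    "'a::chilbert_space set \<Rightarrow> nat \<Rightarrow> (nat \<Rightarrow> 'a \<Rightarrow> 'a) \<Rightarrow> ('a \<Rightarrow> 'a) \<Rightarrow> 'a \<Rightarrow> 'a" where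
  "id_minus_Phi H m Z Y = (\<lambda>h. Y h - Phi H m Z Y h)"

text \<open>\<open>foldr f [1, \<dots>, k] = f 1 \<circ> \<dots> \<circ> f k\<close>\<close>

definition defect_map ::
    "nat \<Rightarrow> (nat \<Rightarrow> nat) \<Rightarrow> 'a::chilbert_space set \<Rightarrow> (nat \<Rightarrow> nat) \<Rightarrow> 'a op_tuple \<Rightarrow> ('a \<Rightarrow> 'a) \<Rightarrow> 'a \<Rightarrow> 'a" where
  "defect_map k n H p X = foldr (\<lambda>i. id_minus_Phi H (n i) (X i) ^^ p i) [1..<k+1]"

definition regular_polyball ::
    "nat \<Rightarrow> (nat \<Rightarrow> nat) \<Rightarrow> 'a::chilbert_space set \<Rightarrow> 'a op_tuple set" where
  "regular_polyball k n H = {X.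
     (\<forall>i\<in>{1..k}. \<forall>j\<in>{1..n i}. bounded_op H H (X i j)) \<and>
     (\<forall>s\<in>{1..k}. \<forall>t\<in>{1..k}. s \<noteq> t \<longrightarrow>
        (\<forall>j\<in>{1..n s}. \<forall>l\<in>{1..n t}. \<forall>h\<in>H. X s j (X t l h) = X t l (X s j h))) \<and>
     (\<forall>p. (\<forall>i\<in>{1..k}. p i \<in> {0, 1}) \<longrightarrow> positive_op H (defect_map k n H p X (\<lambda>h. h)))}"

definition defect_op ::
    "nat \<Rightarrow> (nat \<Rightarrow> nat) \<Rightarrow> 'a::chilbert_space set \<Rightarrow> 'a op_tuple \<Rightarrow> 'a \<Rightarrow> 'a" where
  "defect_op k n H X = defect_map k n H (\<lambda>_. 1) X (\<lambda>h. h)"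

definition polyball_rank ::
    "nat \<Rightarrow> (nat \<Rightarrow> nat) \<Rightarrow> 'a::chilbert_space set \<Rightarrow> 'a op_tuple \<Rightarrow> enat" where
  "polyball_rank k n H X = rank_op H (defect_op k n H X)"

definition pure_tuple ::
    "nat \<Rightarrow> (nat \<Rightarrow> nat) \<Rightarrow> 'a::chilbert_space set \<Rightarrow> 'a op_tuple \<Rightarrow> bool" where
  "pure_tuple k n H X \<longleftrightarrow>
     (\<forall>i\<in>{1..k}. \<forall>x\<in>H. \<forall>y\<in>H.
        (\<lambda>q. cinner ((Phi H (n i) (X i) ^^ q) (\<lambda>h. h) x) y) \<longlonglongrightarrow> 0)"

definition unitarily_equivalent ::
    "nat \<Rightarrow> (nat \<Rightarrow> nat) \<Rightarrow> 'a::chilbert_space set \<Rightarrow> 'a op_tuple \<Rightarrow>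
     'b::chilbert_space set \<Rightarrow> 'b op_tuple \<Rightarrow> bool" where
  "unitarily_equivalent k n H X H' X' \<longleftrightarrow>
     (\<exists>U. unitary_op H H' U \<and>
        (\<forall>i\<in>{1..k}. \<forall>j\<in>{1..n i}. \<forall>h\<in>H. U (X i j h) = X' i j (U h)))"


section \<open>Fock spaces, the Berezin kernel and the curvature\<close>

text \<open>A word over the generators of the \<open>i\<close>-th free semigroup is a list over \<open>{1..n i}\<close>, and
  \<open>multiwords k n\<close> is the product of these free semigroups.\<close>

definition multiwords :: "nat \<Rightarrow> (nat \<Rightarrow> nat) \<Rightarrow> (nat \<Rightarrow> nat list) set" where
  "multiwords k n = (\<Pi>\<^sub>E i\<in>{1..k}. lists {1..n i})"

text \<open>The words index an orthonormal basis of a full Fock space.  Accordingly the Hilbert tensor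
  product \<open>F\<^sup>2(H\<^bsub>n 1\<^esub>) \<otimes> \<dots> \<otimes> F\<^sup>2(H\<^bsub>n k\<^esub>) \<otimes> D\<close> is the space of square summable \<open>D\<close>-valued families
  indexed by \<open>multiwords k n\<close>: the vector \<open>e\<^bsub>\<beta> 1\<^esub> \<otimes> \<dots> \<otimes> e\<^bsub>\<beta> k\<^esub> \<otimes> x\<close> is \<open>ell2_single \<beta> x\<close>.  With
  \<open>D = \<complex>\<close> this is the tensor product of the Fock spaces alone.\<close>

definition fock_tensor ::
    "nat \<Rightarrow> (nat \<Rightarrow> nat) \<Rightarrow> 'a::chilbert_space set \<Rightarrow> (nat \<Rightarrow> nat list, 'a) ell2 set" where
  "fock_tensor k n D = {f. (\<forall>\<beta>\<in>multiwords k n. Rep_ell2 f \<beta> \<in> D) \<and>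
                           (\<forall>\<beta>. \<beta> \<notin> multiwords k n \<longrightarrow> Rep_ell2 f \<beta> = 0)}"

text \<open>\<open>level_proj k n q\<close> is \<open>P\<^bsub>q 1\<^esub> \<otimes> \<dots> \<otimes> P\<^bsub>q k\<^esub> \<otimes> I\<close>: it keeps the basis vectors whose \<open>i\<close>-th word has
  length \<open>q i\<close>, for every \<open>i\<close>.\<close>

definition level_proj ::
    "nat \<Rightarrow> (nat \<Rightarrow> nat) \<Rightarrow> (nat \<Rightarrow> nat) \<Rightarrow>
     (nat \<Rightarrow> nat list, 'a::chilbert_space) ell2 \<Rightarrow> (nat \<Rightarrow> nat list, 'a) ell2" where
  "level_proj k n q = ell2_restrict {\<beta> \<in> multiwords k n. \<forall>i\<in>{1..k}. length (\<beta> i) = q i}"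

definition word_op :: "(nat \<Rightarrow> 'a \<Rightarrow> 'a) \<Rightarrow> nat list \<Rightarrow> 'a \<Rightarrow> 'a" where
  "word_op Z w = foldr Z w"

definition defect_space ::
    "nat \<Rightarrow> (nat \<Rightarrow> nat) \<Rightarrow> 'a::chilbert_space set \<Rightarrow> 'a op_tuple \<Rightarrow> 'a set" where
  "defect_space k n H X = closure (defect_op k n H X ` H)"

definition berezin_kernel ::
    "nat \<Rightarrow> (nat \<Rightarrow> nat) \<Rightarrow> 'a::chilbert_space set \<Rightarrow> 'a op_tuple \<Rightarrow>
     'a \<Rightarrow> (nat \<Rightarrow> nat list, 'a) ell2" where
  "berezin_kernel k n H X h =
     (\<Sum>\<^sub>\<infinity>\<beta>\<in>multiwords k n.
        ell2_single \<beta>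
          (sqrt_op H (defect_op k n H X)
            (foldr (\<lambda>i. adj_op H H (word_op (X i) (\<beta> i))) [1..<k+1] h)))"

definition curvature ::
    "nat \<Rightarrow> (nat \<Rightarrow> nat) \<Rightarrow> 'a::chilbert_space set \<Rightarrow> 'a op_tuple \<Rightarrow> complex" where
  "curvature k n H X =
     lim (\<lambda>m. (\<Sum>q | q \<in> extensional {1..k} \<and> (\<Sum>i=1..k. q i) \<le> m.
                  trace_op H (\<lambda>h. adj_op H (fock_tensor k n (defect_space k n H X)) (berezin_kernel k n H X)
                                    (level_proj k n q (berezin_kernel k n H X h)))
                / trace_op (fock_tensor k n (UNIV :: complex set)) (level_proj k n q))
              / of_nat ((m + k) choose k))"

end

theory Submission
  imports Defs
begin

text \<open>Let \<open>A\<close> be a set of multiwords containing the empty one and closed under deleting the first letter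
  of any coordinate.  The compression of the left creation operators to \<open>H = \<ell>\<^sup>2(A)\<close>, a coinvariant
  subspace of the tensor product of the Fock spaces, is pure and has the projection onto the vacuum as
  its defect operator, so it has rank one.  Its Berezin kernel is the inclusion
  \<open>f \<mapsto> f \<otimes> vac\<close>, and its curvature is therefore the Cesaro limit of the density of \<open>A\<close> in the
  levels of the multiwords.  A unitary equivalence preserves the vacuum up to a scalar, hence also
  which of its translates vanish, so it determines \<open>A\<close>.  It remains to find uncountably many \<open>A\<close> of
  density \<open>t\<close>.  Words of length \<open>q\<close> over \<open>N \<ge> 2\<close> letters correspond to the \<open>N\<close>-adic subintervals of
  length \<open>N\<^sup>-\<^sup>q\<close> of \<open>[0, 1]\<close>, and deleting the first letter enlarges the interval; for
  \<open>0 < s < 1 - t\<close> take the multiwords whose \<open>i\<close>-th word has an interval meeting \<open>(s, s + t)\<close>.\<close>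

section \<open>Operators on complex Hilbert spaces\<close>

lemma cinner_add_right: "cinner x (y + z) = cinner x y + cinner x (z::'a::complex_inner)"
  by (metis cinner_add_left cinner_commute complex_cnj_add)

lemma cinner_scaleC_right: "cinner x (c *\<^sub>C y) = cnj c * cinner x (y::'a::complex_inner)"
  by (metis cinner_commute cinner_scaleC_left complex_cnj_mult)

lemma cinner_zero_left [simp]: "cinner 0 (y::'a::complex_inner) = 0"
  using cinner_add_left[of 0 0 y] by simp

lemma cinner_zero_right [simp]: "cinner (x::'a::complex_inner) 0 = 0"
  using cinner_add_right[of x 0 0] by simp

lemma cinner_diff_left: "cinner (x - y) z = cinner x z - cinner y (z::'a::complex_inner)"
  using cinner_add_left[of "x - y" y z] by simp

lemma cinner_diff_right: "cinner x (y - z) = cinner x y - cinner x (z::'a::complex_inner)"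
  using cinner_add_right[of x "y - z" z] by simp

lemma cinner_sum_left: "cinner (\<Sum>i\<in>F. f i) y = (\<Sum>i\<in>F. cinner (f i) (y::'a::complex_inner))"
  by (induction F rule: infinite_finite_induct) (simp_all add: cinner_add_left)

lemma cinner_sum_right: "cinner x (\<Sum>i\<in>F. f i) = (\<Sum>i\<in>F. cinner x (f i::'a::complex_inner))"
  by (induction F rule: infinite_finite_induct) (simp_all add: cinner_add_right)

lemma cinner_self_eq_0 [simp]: "cinner x x = 0 \<longleftrightarrow> x = (0::'a::complex_inner)"
  by (simp add: cinner_self)

section \<open>Orthonormal expansions and Parseval's identity\<close>

text \<open>Completing the square in each coefficient. The choice \<open>a e = cinner x e\<close>
  yields Bessel's inequality, and dropping the last sum bounds the distance to any linear
  combination from below.\<close>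

lemma orthonormal_expansion_distance:
  fixes x :: "'a::complex_inner"
  assumes F: "finite F"
    and orth: "\<And>e f. e \<in> F \<Longrightarrow> f \<in> F \<Longrightarrow> cinner e f = (if e = f then 1 else 0)"
  shows "(norm (x - (\<Sum>e\<in>F. a e *\<^sub>C e)))\<^sup>2 =
    (norm x)\<^sup>2 - (\<Sum>e\<in>F. (cmod (cinner x e))\<^sup>2) + (\<Sum>e\<in>F. (cmod (cinner x e - a e))\<^sup>2)"
proof -
  define y where "y = (\<Sum>e\<in>F. a e *\<^sub>C e)"
  have xy: "cinner x y = (\<Sum>e\<in>F. cnj (a e) * cinner x e)"
    by (simp add: y_def cinner_sum_right cinner_scaleC_right)
  have "cinner e y = cnj (a e)" if "e \<in> F" for e
    using that F by (simp add: y_def cinner_sum_right cinner_scaleC_right orth if_distrib sum.delta' cong: if_cong)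
  then have yy: "cinner y y = (\<Sum>e\<in>F. a e * cnj (a e))"
    by (subst (1) y_def) (simp add: cinner_sum_left cinner_scaleC_left)
  have "(norm (x - y))\<^sup>2 = (norm x)\<^sup>2 - 2 * Re (cinner x y) + Re (cinner y y)"
    unfolding power2_norm_eq_inner by (simp add: inner_diff inner_commute inner_eq_Re_cinner[symmetric])
  also have "\<dots> = (norm x)\<^sup>2 + (\<Sum>e\<in>F. Re (a e * cnj (a e)) - 2 * Re (cnj (a e) * cinner x e))"
    by (simp add: xy yy sum_subtractf sum_distrib_left)
  also have "(\<Sum>e\<in>F. Re (a e * cnj (a e)) - 2 * Re (cnj (a e) * cinner x e)) =
      (\<Sum>e\<in>F. (cmod (cinner x e - a e))\<^sup>2 - (cmod (cinner x e))\<^sup>2)"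
    unfolding cmod_power2 by (intro sum.cong refl) (simp add: power2_eq_square algebra_simps)
  finally show ?thesis by (simp add: y_def sum_subtractf)
qed

text \<open>Density of the span brings some finite partial sum within \<open>r\<close> of the
  squared norm; partial sums increase with the index set and are capped by Bessel's
  inequality.\<close>

lemma Parseval_has_sum:
  fixes x :: "'a::chilbert_space"
  assumes E: "orthonormal_basis H E" and x: "x \<in> H"
  shows "((\<lambda>e. (cmod (cinner x e))\<^sup>2) has_sum (norm x)\<^sup>2) E"
  unfolding has_sum_def
proof (rule tendstoI)
  fix r :: real assume r: "r > 0"
  have orth: "cinner e f = (if e = f then 1 else 0)" if "e \<in> E" "f \<in> E" for e f
    using E that by (auto simp: orthonormal_basis_def)
  have "x \<in> closure (complex_vector.span E)"
    using E x by (simp add: orthonormal_basis_def)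
  \<comment> \<open>The radius is \<open>sqrt r\<close> because the expansion identity controls
    squared distances.\<close>
  then obtain y where y: "y \<in> complex_vector.span E" "dist y x < sqrt r"
    using r unfolding closure_approachable by (meson real_sqrt_gt_zero)
  then obtain F a where F: "finite F" "F \<subseteq> E" and ya: "y = (\<Sum>e\<in>F. a e *\<^sub>C e)"
    unfolding complex_vector.span_explicit by blast
  have "(norm (x - y))\<^sup>2 < r"
    using y(2) r by (metis abs_norm_cancel dist_commute dist_norm real_sqrt_abs real_sqrt_less_iff)
  moreover have "(norm x)\<^sup>2 - (\<Sum>e\<in>F. (cmod (cinner x e))\<^sup>2) \<le> (norm (x - y))\<^sup>2"
    using orthonormal_expansion_distance[OF F(1), of x a] F(2) orth unfolding ya
    by (simp add: subset_iff sum_nonneg)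
  ultimately have low: "(norm x)\<^sup>2 - r < (\<Sum>e\<in>F. (cmod (cinner x e))\<^sup>2)" by simp
  have "dist (\<Sum>e\<in>G. (cmod (cinner x e))\<^sup>2) ((norm x)\<^sup>2) < r" if G: "finite G" "F \<subseteq> G" "G \<subseteq> E" for G
  proof -
    have "(\<Sum>e\<in>F. (cmod (cinner x e))\<^sup>2) \<le> (\<Sum>e\<in>G. (cmod (cinner x e))\<^sup>2)"
      by (intro sum_mono2 G) simp
    moreover have "0 \<le> (norm x)\<^sup>2 - (\<Sum>e\<in>G. (cmod (cinner x e))\<^sup>2)"
      using orthonormal_expansion_distance[OF G(1), of x "\<lambda>e. cinner x e"] G(3) orth
      by (smt (verit) subsetD sum.neutral zero_le_power2 norm_zero power_zero_numeral diff_self)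
    ultimately show ?thesis using low by (simp add: dist_real_def)
  qed
  then show "\<forall>\<^sub>F G in finite_subsets_at_top E. dist (\<Sum>e\<in>G. (cmod (cinner x e))\<^sup>2) ((norm x)\<^sup>2) < r"
    unfolding eventually_finite_subsets_at_top using F by blast
qed

section \<open>Adjoints and positive square roots\<close>

text \<open>Two vectors of \<open>H\<close> representing the same functional differ by a vector of
  \<open>H\<close> orthogonal to itself, so exhibiting one of them settles the definite
  description.\<close>

lemma adj_op_eqI:
  fixes H :: "'a::chilbert_space set"
  assumes H: "complex_vector.subspace H" and "y \<in> K" "z \<in> H"
    and adj: "\<And>x. x \<in> H \<Longrightarrow> cinner (B x) y = cinner x z"
  shows "adj_op H K B y = z"
proof -
  have "(THE z. z \<in> H \<and> (\<forall>x\<in>H. cinner (B x) y = cinner x z)) = z"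
  proof (rule the_equality)
    fix w assume w: "w \<in> H \<and> (\<forall>x\<in>H. cinner (B x) y = cinner x w)"
    then have "w - z \<in> H" using H \<open>z \<in> H\<close> by (simp add: complex_vector.subspace_diff)
    then have "cinner (w - z) (w - z) = 0"
      using w adj by (simp add: cinner_diff_right)
    then show "w = z" by simp
  qed (use assms in auto)
  then show ?thesis using \<open>y \<in> K\<close> by (simp add: adj_op_def)
qed

text \<open>Polarisation: the quadratic form is real at \<open>u\<close>, \<open>y\<close> and
  \<open>u + y\<close>, hence so is the sum of the cross terms.\<close>

lemma positive_op_self_adjoint:
  fixes H :: "'a::chilbert_space set"
  assumes H: "complex_vector.subspace H" and S: "positive_op H S" and x: "x \<in> H" and y: "y \<in> H"
  shows "cinner (S x) y = cinner x (S y)"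
proof -
  have add: "S (u + v) = S u + S v" if "u \<in> H" "v \<in> H" for u v
    using S that by (auto simp: positive_op_def bounded_op_def)
  have scale: "S (c *\<^sub>C u) = c *\<^sub>C S u" if "u \<in> H" for u c
    using S that by (auto simp: positive_op_def bounded_op_def)
  have real: "Im (cinner (S u) u) = 0" if "u \<in> H" for u
    using S that by (auto simp: positive_op_def complex_nonneg_Reals_iff)
  have *: "Im (cinner (S u) y) + Im (cinner (S y) u) = 0" if "u \<in> H" for u
    using real[of "u + y"] real[of u] real[of y] that y H
    by (simp add: add complex_vector.subspace_add cinner_add_left cinner_add_right)
  \<comment> \<open>Taking \<open>u = x\<close> compares imaginary parts, and taking
    \<open>u = \<i> *\<^sub>C x\<close> compares real parts.\<close>
  have "\<i> *\<^sub>C x \<in> H" using H x by (simp add: complex_vector.subspace_scale)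
  from *[OF this] *[OF x] have "cinner (S x) y = cnj (cinner (S y) x)"
    by (simp add: scale x cinner_scaleC_left cinner_scaleC_right complex_eq_iff)
  then show ?thesis by (simp add: cinner_commute[of x])
qed

text \<open>A rank one projection is its own positive root. For uniqueness, a root \<open>S\<close>
  maps \<open>v\<close> to \<open>l *\<^sub>C v\<close> with \<open>l * l = 1\<close> and
  \<open>l\<close> nonnegative, and it kills every \<open>u\<close> orthogonal to \<open>v\<close>
  since the squared norm of \<open>S u\<close> is \<open>cinner (S (S u)) u\<close>.\<close>

lemma sqrt_op_rank_one:
  fixes H :: "'a::chilbert_space set"
  assumes H: "complex_vector.subspace H" and v: "v \<in> H" "norm v = 1"
    and B: "\<And>x. x \<in> H \<Longrightarrow> B x = cinner x v *\<^sub>C v"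
  shows "sqrt_op H B = (\<lambda>x. if x \<in> H then cinner x v *\<^sub>C v else 0)"
  unfolding sqrt_op_def
proof (rule the_equality)
  have vv: "cinner v v = 1" using v by (simp add: cinner_self)
  let ?P = "\<lambda>x. if x \<in> H then cinner x v *\<^sub>C v else 0"
  have mem: "c *\<^sub>C v \<in> H" for c using H v by (simp add: complex_vector.subspace_scale)
  have "norm (cinner x v *\<^sub>C v) \<le> 2 * norm x" for x
    using norm_cinner_le[of x v] v by (simp add: norm_scaleC)
  then have "bounded_op H H ?P"
    using H mem by (auto simp: bounded_op_def complex_vector.subspace_add complex_vector.subspace_scale
        cinner_add_left cinner_scaleC_left scaleC_add_left scaleC_scaleC intro!: exI[of _ 2])
  moreover have "cinner (cinner x v *\<^sub>C v) x \<in> \<real>\<^sub>\<ge>\<^sub>0" for x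
    by (metis cinner_commute cinner_scaleC_left complex_norm_square nonneg_Reals_of_real_iff zero_le_power2)
  ultimately show "positive_op H ?P \<and> (\<forall>x\<in>H. ?P (?P x) = B x) \<and> (\<forall>x. x \<notin> H \<longrightarrow> ?P x = 0)"
    by (auto simp: positive_op_def B mem cinner_scaleC_left vv)
  fix S assume S: "positive_op H S \<and> (\<forall>x\<in>H. S (S x) = B x) \<and> (\<forall>x. x \<notin> H \<longrightarrow> S x = 0)"
  have SH: "S x \<in> H" if "x \<in> H" for x
    using S that by (auto simp: positive_op_def bounded_op_def)
  have add: "S (u + w) = S u + S w" if "u \<in> H" "w \<in> H" for u w
    using S that by (auto simp: positive_op_def bounded_op_def)
  have scale: "S (c *\<^sub>C u) = c *\<^sub>C S u" if "u \<in> H" for u c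
    using S that by (auto simp: positive_op_def bounded_op_def)
  have SS: "S (S x) = cinner x v *\<^sub>C v" if "x \<in> H" for x using S B that by auto
  define l where "l = cinner (S v) v"
  \<comment> \<open>The cube of \<open>S\<close> at \<open>v\<close> is evaluated in two ways, which
    makes \<open>v\<close> an eigenvector.\<close>
  have "S (S (S v)) = S v" using SS[OF v(1)] vv by (simp add: scaleC_one)
  then have Sv: "S v = l *\<^sub>C v" using SS[OF SH[OF v(1)]] by (simp add: l_def)
  have "l \<in> \<real>\<^sub>\<ge>\<^sub>0" using S v by (auto simp: positive_op_def l_def)
  moreover have "l * l = 1"
  proof -
    have "v = (l * l) *\<^sub>C v"
      using SS[OF v(1)] vv by (simp add: Sv scale v scaleC_scaleC scaleC_one)
    then have "cinner v v = (l * l) * cinner v v" by (metis cinner_scaleC_left)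
    then show ?thesis using vv by simp
  qed
  ultimately have l1: "l = 1"
    by (smt (verit) complex_nonneg_Reals_iff one_complex.sel(1) one_neq_neg_one power2_eq_1_iff power2_eq_square uminus_complex.sel(1))
  have "S x = cinner x v *\<^sub>C v" if x: "x \<in> H" for x
  proof -
    define u where "u = x - cinner x v *\<^sub>C v"
    have u: "u \<in> H" using H x mem by (simp add: u_def complex_vector.subspace_diff)
    have "cinner u v = 0" by (simp add: u_def cinner_diff_left cinner_scaleC_left vv)
    then have "cinner (S u) (S u) = 0"
      using positive_op_self_adjoint[OF H _ SH[OF u] u, of S] S SS[OF u] by simp
    then have "S u = 0" by simp
    moreover have "x = u + cinner x v *\<^sub>C v" by (simp add: u_def)
    ultimately show ?thesis
      using add[OF u mem[of "cinner x v"]] scale[OF v(1)] Sv l1 by (simp add: scaleC_one)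
  qed
  then show "S = ?P" using S by auto
qed

section \<open>Square summable families\<close>

text \<open>The error after a finite \<open>F\<close> is \<open>f\<close> cut off outside
  \<open>F\<close>, whose squared norm is a tail of a convergent series. The set \<open>M\<close>
  may exceed the support: in the Berezin kernel it consists of all multiwords.\<close>

lemma has_sum_ell2_single:
  fixes f :: "('i, 'a::chilbert_space) ell2"
  assumes M: "\<And>i. i \<notin> M \<Longrightarrow> Rep_ell2 f i = 0"
  shows "((\<lambda>i. ell2_single i (Rep_ell2 f i)) has_sum f) M"
  unfolding has_sum_def
proof (rule tendstoI)
  fix r :: real assume r: "r > 0"
  have "((\<lambda>i. (norm (Rep_ell2 f i))\<^sup>2) has_sum (norm f)\<^sup>2) UNIV"
    unfolding norm_ell2_square by (intro has_sum_infsum Rep_ell2_summable)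
  then have "((\<lambda>i. (norm (Rep_ell2 f i))\<^sup>2) has_sum (norm f)\<^sup>2) M"
    by (subst has_sum_cong_neutral[where T = UNIV]) (use M in auto)
  then have "\<forall>\<^sub>F F in finite_subsets_at_top M. dist (\<Sum>i\<in>F. (norm (Rep_ell2 f i))\<^sup>2) ((norm f)\<^sup>2) < r\<^sup>2"
    unfolding has_sum_def using r by (intro tendstoD) auto
  moreover have "\<forall>\<^sub>F F in finite_subsets_at_top M. finite F"
    by (auto simp: eventually_finite_subsets_at_top)
  ultimately show "\<forall>\<^sub>F F in finite_subsets_at_top M. dist (\<Sum>i\<in>F. ell2_single i (Rep_ell2 f i)) f < r"
  proof eventually_elim
    case (elim F)
    define g where "g = f - (\<Sum>i\<in>F. ell2_single i (Rep_ell2 f i))"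
    have Rep_sum: "Rep_ell2 (\<Sum>i\<in>F. ell2_single i (c i)) j = (\<Sum>i\<in>F. if j = i then c i else 0)"
      for c :: "'i \<Rightarrow> 'a" and j
      by (induction F rule: infinite_finite_induct)
        (simp_all add: zero_ell2.rep_eq plus_ell2.rep_eq ell2_single.rep_eq)
    have g: "Rep_ell2 g j = (if j \<in> F then 0 else Rep_ell2 f j)" for j
      using elim(2) by (simp add: g_def minus_ell2.rep_eq Rep_sum)
    have "(norm f)\<^sup>2 = (\<Sum>\<^sub>\<infinity>i\<in>F \<union> - F. (norm (Rep_ell2 f i))\<^sup>2)"
      by (simp add: norm_ell2_square)
    also have "\<dots> = (\<Sum>i\<in>F. (norm (Rep_ell2 f i))\<^sup>2) + (\<Sum>\<^sub>\<infinity>i\<in>-F. (norm (Rep_ell2 f i))\<^sup>2)"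
      using elim(2) by (subst infsum_Un_disjoint)
        (auto intro: summable_on_subset_banach[OF Rep_ell2_summable])
    also have "(\<Sum>\<^sub>\<infinity>i\<in>-F. (norm (Rep_ell2 f i))\<^sup>2) = (norm g)\<^sup>2"
      unfolding norm_ell2_square by (rule infsum_cong_neutral) (auto simp: g)
    finally have "(norm g)\<^sup>2 < r\<^sup>2"
      using elim(1) by (simp add: dist_real_def)
    then have "norm g < r" using r by (simp add: power_less_imp_less_base)
    then show ?case by (simp add: g_def dist_norm norm_minus_commute)
  qed
qed

section \<open>The Hilbert space of families supported on a set\<close>

definition ell2_supp :: "'i set \<Rightarrow> ('i, 'a::chilbert_space) ell2 set" where
  "ell2_supp A = {f. \<forall>i. i \<notin> A \<longrightarrow> Rep_ell2 f i = 0}"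

lemma ell2_suppI: "(\<And>i. i \<notin> A \<Longrightarrow> Rep_ell2 f i = 0) \<Longrightarrow> f \<in> ell2_supp A"
  by (simp add: ell2_supp_def)

lemma ell2_suppD: "f \<in> ell2_supp A \<Longrightarrow> i \<notin> A \<Longrightarrow> Rep_ell2 f i = 0"
  by (simp add: ell2_supp_def)

lemma ell2_eqI: "(\<And>i. Rep_ell2 f i = Rep_ell2 g i) \<Longrightarrow> f = g"
  by (simp add: Rep_ell2_inject[symmetric] fun_eq_iff)

lemma subspace_ell2_supp: "complex_vector.subspace (ell2_supp A)"
  by (simp add: complex_vector.subspace_def ell2_supp_def zero_ell2.rep_eq plus_ell2.rep_eq
      scaleC_ell2.rep_eq)

lemma bounded_linear_Rep_ell2: "bounded_linear (\<lambda>f. Rep_ell2 f i)"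
  by (rule bounded_linear_intro[of _ 1])
    (simp_all add: plus_ell2.rep_eq scaleR_ell2.rep_eq norm_Rep_ell2_le)

lemma hilbert_subspace_ell2_supp: "hilbert_subspace (ell2_supp A :: ('a, 'b::chilbert_space) ell2 set)"
proof -
  have "ell2_supp A = (\<Inter>i\<in>-A. {f :: ('a, 'b) ell2. Rep_ell2 f i = 0})"
    by (auto simp: ell2_supp_def)
  moreover have "closed {f :: ('a, 'b) ell2. Rep_ell2 f i = 0}" for i
    by (intro closed_Collect_eq continuous_on_const
        bounded_linear.continuous_on[OF bounded_linear_Rep_ell2 continuous_on_id])
  ultimately have "closed (ell2_supp A :: ('a, 'b) ell2 set)" by auto
  then show ?thesis by (simp add: hilbert_subspace_def subspace_ell2_supp)
qed

lemma cinner_ell2_single: "cinner (f :: ('i, complex) ell2) (ell2_single i 1) = Rep_ell2 f i"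
proof -
  have "(\<Sum>\<^sub>\<infinity>j. cinner (Rep_ell2 f j) (Rep_ell2 (ell2_single i 1) j)) =
      (\<Sum>\<^sub>\<infinity>j\<in>{i}. cinner (Rep_ell2 f j) (Rep_ell2 (ell2_single i (1::complex)) j))"
    by (rule infsum_cong_neutral) (auto simp: ell2_single.rep_eq)
  then show ?thesis by (simp add: cinner_ell2_def ell2_single.rep_eq cinner_complex_def)
qed

lemma norm_ell2_single: "norm (ell2_single i (1::complex)) = 1"
  using cinner_self[of "ell2_single i (1::complex)"]
  by (simp add: cinner_ell2_single ell2_single.rep_eq flip: of_real_power)
    (metis norm_ge_zero of_real_eq_1_iff power2_eq_1_iff not_one_le_zero neg_0_le_iff_le order_trans zero_le_one)

lemma ell2_single_eq_iff [simp]: "ell2_single i (1::complex) = ell2_single j 1 \<longleftrightarrow> i = j"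
  by (metis ell2_single.rep_eq zero_neq_one)

text \<open>The value of \<open>trace_op\<close> is unique only if some orthonormal basis exists;
  this one serves. Its span is dense by norm convergence of the coordinate expansion.\<close>

lemma orthonormal_basis_ell2_supp:
  "orthonormal_basis (ell2_supp A) ((\<lambda>i. ell2_single i (1::complex)) ` A)"
  unfolding orthonormal_basis_def
proof (intro conjI)
  let ?E = "(\<lambda>i. ell2_single i (1::complex)) ` A"
  show sub: "?E \<subseteq> ell2_supp A"
    by (auto simp: ell2_supp_def ell2_single.rep_eq)
  show "\<forall>x\<in>?E. \<forall>y\<in>?E. cinner x y = (if x = y then 1 else 0)"
    by (auto simp: cinner_ell2_single ell2_single.rep_eq)
  show "closure (complex_vector.span ?E) = ell2_supp A"
  proof
    show "closure (complex_vector.span ?E) \<subseteq> ell2_supp A"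
      using hilbert_subspace_ell2_supp[of A] sub
      by (intro closure_minimal complex_vector.span_minimal) (auto simp: hilbert_subspace_def)
    show "ell2_supp A \<subseteq> closure (complex_vector.span ?E)"
    proof
      fix f :: "('a, complex) ell2" assume f: "f \<in> ell2_supp A"
      have "ell2_single i (Rep_ell2 f i) \<in> complex_vector.span ?E" if "i \<in> A" for i
      proof -
        have "ell2_single i (Rep_ell2 f i) = Rep_ell2 f i *\<^sub>C ell2_single i 1"
          by (intro ell2_eqI) (simp add: ell2_single.rep_eq scaleC_ell2.rep_eq scaleC_complex_def)
        moreover have "\<dots> \<in> complex_vector.span ?E"
          using that by (intro complex_vector.span_scale complex_vector.span_base) blast
        ultimately show ?thesis by simp
      qed
      then have "\<forall>\<^sub>F F in finite_subsets_at_top A.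
          (\<Sum>i\<in>F. ell2_single i (Rep_ell2 f i)) \<in> closure (complex_vector.span ?E)"
        by (intro eventually_finite_subsets_at_top_weakI)
          (blast intro: complex_vector.span_sum closure_subset[THEN subsetD])
      then show "f \<in> closure (complex_vector.span ?E)"
        using has_sum_ell2_single[of A f] ell2_suppD[OF f]
        unfolding has_sum_def
        by (intro Lim_in_closed_set[OF closed_closure]) auto
    qed
  qed
qed

lemma has_sum_sum:
  fixes f :: "'i \<Rightarrow> 'e \<Rightarrow> 'a::topological_comm_monoid_add"
  assumes "finite B" "\<And>i. i \<in> B \<Longrightarrow> (f i has_sum s i) E"
  shows "((\<lambda>e. \<Sum>i\<in>B. f i e) has_sum (\<Sum>i\<in>B. s i)) E"
  using assms by (induction B rule: finite_induct) (simp_all add: has_sum_add)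

text \<open>In any orthonormal basis the diagonal entry at \<open>e\<close> is the sum over
  \<open>i \<in> B\<close> of the squared moduli of the coordinates of \<open>e\<close>. For fixed
  \<open>i\<close>, summing over \<open>e\<close> gives the squared norm of the \<open>i\<close>-th
  unit vector by Parseval, so each \<open>i \<in> B\<close> contributes 1.\<close>

lemma trace_op_ell2_restrict:
  assumes B: "finite B" "B \<subseteq> A"
    and op: "\<And>f. f \<in> ell2_supp A \<Longrightarrow> S f = ell2_restrict B f"
  shows "trace_op (ell2_supp A) (S :: ('i, complex) ell2 \<Rightarrow> _) = of_nat (card B)"
proof -
  have S: "cinner (S f) f = (\<Sum>i\<in>B. of_real ((cmod (Rep_ell2 f i))\<^sup>2))" if "f \<in> ell2_supp A" for f
  proof -
    have "cinner (S f) f = (\<Sum>\<^sub>\<infinity>i\<in>B. of_real ((cmod (Rep_ell2 f i))\<^sup>2))"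
      unfolding op[OF that] cinner_ell2_def
      by (rule infsum_cong_neutral)
        (auto simp: ell2_restrict.rep_eq cinner_complex_def complex_norm_square[symmetric])
    then show ?thesis using B by simp
  qed
  have main: "((\<lambda>e. cinner (S e) e) has_sum of_nat (card B)) E"
    if E: "orthonormal_basis (ell2_supp A) E" for E
  proof -
    have "((\<lambda>e. complex_of_real ((cmod (Rep_ell2 e i))\<^sup>2)) has_sum 1) E" if "i \<in> B" for i
    proof -
      have "ell2_single i 1 \<in> ell2_supp A"
        using that B by (auto simp: ell2_supp_def ell2_single.rep_eq)
      from Parseval_has_sum[OF E this]
      have "((\<lambda>e. (cmod (Rep_ell2 e i))\<^sup>2) has_sum 1) E"
        by (subst (asm) cinner_commute) (simp add: cinner_ell2_single norm_ell2_single)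
      then have "((\<lambda>e. complex_of_real ((cmod (Rep_ell2 e i))\<^sup>2)) has_sum complex_of_real 1) E"
        by (rule has_sum_of_real)
      then show ?thesis by simp
    qed
    then have "((\<lambda>e. \<Sum>i\<in>B. complex_of_real ((cmod (Rep_ell2 e i))\<^sup>2)) has_sum (\<Sum>i\<in>B. 1)) E"
      by (intro has_sum_sum B)
    moreover have "E \<subseteq> ell2_supp A" using E by (simp add: orthonormal_basis_def)
    ultimately show ?thesis
      by (subst has_sum_cong[of _ _ "\<lambda>e. \<Sum>i\<in>B. complex_of_real ((cmod (Rep_ell2 e i))\<^sup>2)"])
        (auto simp: S simp del: of_real_power)
  qed
  show ?thesis
    unfolding trace_op_def
    using main orthonormal_basis_ell2_supp[of A] has_sum_unique by (intro the_equality) blast+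
qed

section \<open>Composition operators and elementary tensors\<close>

text \<open>Composition with an injective map, extended by zero off \<open>P\<close>. Testing
  injectivity in the body keeps the result square summable for all arguments. Restrictions, shifts
  and coshifts are all instances.\<close>

lift_definition ell2_pull :: "'i set \<Rightarrow> ('i \<Rightarrow> 'j) \<Rightarrow> ('j, 'a) ell2 \<Rightarrow> ('i, 'a::complex_inner) ell2"
  is "\<lambda>P \<phi> f i. if i \<in> P \<and> inj_on \<phi> P then f (\<phi> i) else 0"
proof -
  fix P :: "'i set" and \<phi> :: "'i \<Rightarrow> 'j" and f :: "'j \<Rightarrow> 'a"
  assume f: "(\<lambda>i. (norm (f i))\<^sup>2) summable_on UNIV"
  show "(\<lambda>i. (norm (if i \<in> P \<and> inj_on \<phi> P then f (\<phi> i) else 0))\<^sup>2) summable_on UNIV"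
  proof (cases "inj_on \<phi> P")
    case True
    have "(\<lambda>i. (norm (f i))\<^sup>2) summable_on \<phi> ` P"
      using f by (rule summable_on_subset_banach) simp
    then have "(\<lambda>i. (norm (f (\<phi> i)))\<^sup>2) summable_on P"
      by (subst (asm) summable_on_reindex[OF True]) (simp add: o_def)
    then show ?thesis
      by (subst summable_on_cong_neutral[where T = P]) (use True in auto)
  qed simp
qed

lemma Rep_ell2_pull:
  "inj_on \<phi> P \<Longrightarrow> Rep_ell2 (ell2_pull P \<phi> f) i = (if i \<in> P then Rep_ell2 f (\<phi> i) else 0)"
  by (simp add: ell2_pull.rep_eq)

lemma ell2_pull_add: "ell2_pull P \<phi> (f + g) = ell2_pull P \<phi> f + ell2_pull P \<phi> g"
  by (intro ell2_eqI) (simp add: ell2_pull.rep_eq plus_ell2.rep_eq)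

lemma ell2_pull_scaleC: "ell2_pull P \<phi> (c *\<^sub>C f) = c *\<^sub>C ell2_pull P \<phi> f"
  by (intro ell2_eqI) (simp add: ell2_pull.rep_eq scaleC_ell2.rep_eq)

lemma norm_ell2_pull_le:
  assumes \<phi>: "inj_on \<phi> P"
  shows "norm (ell2_pull P \<phi> f) \<le> norm f"
proof (rule power2_le_imp_le)
  have "(norm (ell2_pull P \<phi> f))\<^sup>2 = (\<Sum>\<^sub>\<infinity>i\<in>P. (norm (Rep_ell2 f (\<phi> i)))\<^sup>2)"
    unfolding norm_ell2_square by (rule infsum_cong_neutral) (auto simp: Rep_ell2_pull[OF \<phi>])
  also have "\<dots> = (\<Sum>\<^sub>\<infinity>i\<in>\<phi> ` P. (norm (Rep_ell2 f i))\<^sup>2)"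
    by (simp add: infsum_reindex[OF \<phi>] o_def)
  also have "\<dots> \<le> (norm f)\<^sup>2"
    unfolding norm_ell2_square
    by (intro infsum_mono_neutral Rep_ell2_summable summable_on_subset_banach[OF Rep_ell2_summable]) auto
  finally show "(norm (ell2_pull P \<phi> f))\<^sup>2 \<le> (norm f)\<^sup>2" .
qed simp

text \<open>Reindexing the inner product along the bijection: the adjoint of composition with
  \<open>\<phi>\<close> is composition with its inverse.\<close>

lemma cinner_ell2_pull:
  assumes \<phi>: "bij_betw \<phi> P Q" and \<psi>: "\<And>i. i \<in> P \<Longrightarrow> \<psi> (\<phi> i) = i"
  shows "cinner (ell2_pull P \<phi> f) g = cinner f (ell2_pull Q \<psi> g)"
proof -
  have inj: "inj_on \<phi> P" and Q: "Q = \<phi> ` P" using \<phi> by (auto simp: bij_betw_def)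
  have inj': "inj_on \<psi> Q" unfolding Q by (rule inj_onI) (use \<psi> in auto)
  have "cinner (ell2_pull P \<phi> f) g = (\<Sum>\<^sub>\<infinity>i\<in>P. cinner (Rep_ell2 f (\<phi> i)) (Rep_ell2 g i))"
    unfolding cinner_ell2_def by (rule infsum_cong_neutral) (auto simp: Rep_ell2_pull[OF inj])
  also have "\<dots> = (\<Sum>\<^sub>\<infinity>i\<in>P. cinner (Rep_ell2 f (\<phi> i)) (Rep_ell2 g (\<psi> (\<phi> i))))"
    by (intro infsum_cong) (simp add: \<psi>)
  also have "\<dots> = (\<Sum>\<^sub>\<infinity>j\<in>Q. cinner (Rep_ell2 f j) (Rep_ell2 g (\<psi> j)))"
    unfolding Q by (simp add: infsum_reindex[OF inj] o_def)
  also have "\<dots> = cinner f (ell2_pull Q \<psi> g)"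
    unfolding cinner_ell2_def by (rule infsum_cong_neutral) (auto simp: Rep_ell2_pull[OF inj'])
  finally show ?thesis .
qed

text \<open>The elementary tensor of \<open>f\<close> and \<open>v\<close>, with the Hilbert tensor
  product read as a space of vector valued families.\<close>

lift_definition ell2_tensor :: "('i, complex) ell2 \<Rightarrow> 'a \<Rightarrow> ('i, 'a::complex_inner) ell2"
  is "\<lambda>f v i. f i *\<^sub>C v"
  by (simp add: norm_scaleC power_mult_distrib summable_on_cmult_left)

lemma cinner_ell2_tensor:
  "cinner (ell2_tensor f v) (ell2_tensor g w) = cinner f g * cinner v w"
proof -
  have "cinner (ell2_tensor f v) (ell2_tensor g w) =
      (\<Sum>\<^sub>\<infinity>i. cinner (Rep_ell2 f i) (Rep_ell2 g i) * cinner v w)"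
    unfolding cinner_ell2_def
    by (intro infsum_cong)
      (simp add: ell2_tensor.rep_eq cinner_scaleC_left cinner_scaleC_right cinner_complex_def algebra_simps)
  also have "\<dots> = cinner f g * cinner v w"
    unfolding cinner_ell2_def by (intro infsum_cmult_left ell2_cinner_summable)
  finally show ?thesis .
qed

lemma Rep_ell2_sum: "Rep_ell2 (\<Sum>j\<in>F. f j) i = (\<Sum>j\<in>F. Rep_ell2 (f j) i)"
  by (induction F rule: infinite_finite_induct) (simp_all add: zero_ell2.rep_eq plus_ell2.rep_eq)

lemma ell2_restrict_eq_pull: "ell2_restrict B = ell2_pull B (\<lambda>i. i)"
  by (intro ext ell2_eqI) (simp add: ell2_restrict.rep_eq ell2_pull.rep_eq)

lemma norm_ell2_restrict_le: "norm (ell2_restrict B f) \<le> norm f"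
  by (simp add: ell2_restrict_eq_pull norm_ell2_pull_le)

lemma ell2_restrict_supp: "f \<in> ell2_supp A \<Longrightarrow> ell2_restrict B f \<in> ell2_supp A"
  by (simp add: ell2_supp_def ell2_restrict.rep_eq)

lemma bounded_op_ell2_pull:
  assumes "inj_on \<phi> P" "P \<subseteq> A"
  shows "bounded_op (ell2_supp A) (ell2_supp A) (ell2_pull P \<phi>)"
  unfolding bounded_op_def using assms
  by (auto simp: ell2_pull_add ell2_pull_scaleC ell2_supp_def Rep_ell2_pull
      intro!: exI[of _ 1] norm_ell2_pull_le)

lemma positive_op_ell2_restrict:
  fixes S :: "('a, 'b::chilbert_space) ell2 \<Rightarrow> ('a, 'b) ell2"
  assumes S: "\<And>f. f \<in> ell2_supp A \<Longrightarrow> S f = ell2_restrict B f"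
  shows "positive_op (ell2_supp A) S"
proof -
  have "cinner (ell2_restrict B f) f = cinner (ell2_restrict B f) (ell2_restrict B f)" for f :: "('a, 'b) ell2"
    unfolding cinner_ell2_def by (intro infsum_cong) (simp add: ell2_restrict.rep_eq)
  moreover have "ell2_restrict B (f + g) = ell2_restrict B f + ell2_restrict B g"
    "ell2_restrict B (c *\<^sub>C f) = c *\<^sub>C ell2_restrict B f" for f g :: "('a, 'b) ell2" and c
    by (simp_all add: ell2_restrict_eq_pull ell2_pull_add ell2_pull_scaleC)
  ultimately show ?thesis
    using complex_vector.subspace_add[OF subspace_ell2_supp[of A, where ?'b = 'b]]
      complex_vector.subspace_scale[OF subspace_ell2_supp[of A, where ?'b = 'b]]
    by (auto simp: positive_op_def bounded_op_def S ell2_restrict_supp cinner_self norm_ell2_restrict_le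
        simp del: of_real_power intro!: exI[of _ 1])
qed

text \<open>Up to an error below \<open>r\<close> the vector has finite support; restriction to
  \<open>B q\<close> eventually annihilates the finite part and does not enlarge the error.\<close>

lemma ell2_restrict_tendsto_0:
  fixes x :: "('i, 'a::chilbert_space) ell2"
  assumes B: "\<And>i. \<forall>\<^sub>F q in G. i \<notin> B q"
  shows "((\<lambda>q. ell2_restrict (B q) x) \<longlongrightarrow> 0) G"
proof (rule tendstoI)
  fix r :: real assume "r > 0"
  then have "\<forall>\<^sub>F F in finite_subsets_at_top UNIV. dist (\<Sum>i\<in>F. ell2_single i (Rep_ell2 x i)) x < r"
    using has_sum_ell2_single[of UNIV x] unfolding has_sum_def by (intro tendstoD) auto
  then obtain F where F: "finite F" and d: "dist (\<Sum>i\<in>F. ell2_single i (Rep_ell2 x i)) x < r"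
    by (auto simp: eventually_finite_subsets_at_top)
  define s where "s = (\<Sum>i\<in>F. ell2_single i (Rep_ell2 x i))"
  have s: "Rep_ell2 s j = 0" if "j \<notin> F" for j
    using that F unfolding s_def Rep_ell2_sum by (intro sum.neutral) (auto simp: ell2_single.rep_eq)
  have "\<forall>\<^sub>F q in G. \<forall>i\<in>F. i \<notin> B q"
    using F B by (simp add: eventually_ball_finite)
  then show "\<forall>\<^sub>F q in G. dist (ell2_restrict (B q) x) 0 < r"
  proof eventually_elim
    case (elim q)
    then have "ell2_restrict (B q) x = ell2_restrict (B q) (x - s)"
      by (intro ell2_eqI) (auto simp: ell2_restrict.rep_eq minus_ell2.rep_eq s)
    then have "norm (ell2_restrict (B q) x) \<le> norm (x - s)"
      by (simp add: norm_ell2_restrict_le)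
    then show ?case using d by (simp add: s_def dist_norm norm_minus_commute)
  qed
qed

section \<open>Truncated shifts\<close>

text \<open>In coordinates, the compression to the families supported on \<open>A\<close> of the
  left creation operator for the letter \<open>j\<close> in factor \<open>i\<close>: a basis vector
  gets \<open>j\<close> prepended to its \<open>i\<close>-th word and is sent to zero if this leaves
  \<open>A\<close>.\<close>

definition truncated_shift ::
    "(nat \<Rightarrow> nat list) set \<Rightarrow> nat \<Rightarrow> nat \<Rightarrow> (nat \<Rightarrow> nat list, complex) ell2 \<Rightarrow> (nat \<Rightarrow> nat list, complex) ell2" where
  "truncated_shift A i j = ell2_pull {\<beta>\<in>A. \<beta> i \<noteq> [] \<and> hd (\<beta> i) = j} (\<lambda>\<beta>. \<beta>(i := tl (\<beta> i)))"

text \<open>For the sets \<open>A\<close> below, the adjoint of the operator of a whole word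
  \<open>w\<close>: it strips the prefix \<open>w\<close> from basis vectors and therefore prepends
  it in coordinates.\<close>

definition truncated_coshift ::
    "(nat \<Rightarrow> nat list) set \<Rightarrow> nat \<Rightarrow> nat list \<Rightarrow> (nat \<Rightarrow> nat list, complex) ell2 \<Rightarrow> (nat \<Rightarrow> nat list, complex) ell2" where
  "truncated_coshift A i w = ell2_pull {\<beta>. \<beta>(i := w @ \<beta> i) \<in> A} (\<lambda>\<beta>. \<beta>(i := w @ \<beta> i))"

lemma tl_upd_inject:
  assumes eq: "\<beta>(i := tl (\<beta> i)) = \<gamma>(i := tl (\<gamma> i))"
    and "\<beta> i \<noteq> []" "\<gamma> i \<noteq> []" "hd (\<beta> i) = hd (\<gamma> i)"
  shows "\<beta> = \<gamma>"
proof -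
  have "tl (\<beta> i) = tl (\<gamma> i)" using fun_cong[OF eq, of i] by simp
  then have "\<beta> i = \<gamma> i" using assms(2-4) by (simp add: list.expand)
  then show ?thesis using eq by (metis fun_upd_triv fun_upd_upd)
qed

lemma inj_on_tl_upd: "inj_on (\<lambda>\<beta>. \<beta>(i := tl (\<beta> i))) {\<beta>\<in>A. \<beta> i \<noteq> [] \<and> hd (\<beta> i) = j}"
  by (rule inj_onI, rule tl_upd_inject[of _ i]) simp_all

lemma inj_on_append_upd: "inj_on (\<lambda>\<beta>. \<beta>(i := w @ \<beta> i)) P"
proof (rule inj_onI)
  fix \<beta> \<gamma> :: "'a \<Rightarrow> 'b list"
  assume eq: "\<beta>(i := w @ \<beta> i) = \<gamma>(i := w @ \<gamma> i)"
  have "\<beta> i = \<gamma> i" using fun_cong[OF eq, of i] by simp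
  then show "\<beta> = \<gamma>" using eq by (metis fun_upd_triv fun_upd_upd)
qed

lemma Rep_truncated_shift:
  "Rep_ell2 (truncated_shift A i j f) \<beta> =
     (if \<beta> \<in> A \<and> \<beta> i \<noteq> [] \<and> hd (\<beta> i) = j then Rep_ell2 f (\<beta>(i := tl (\<beta> i))) else 0)"
  by (simp add: truncated_shift_def Rep_ell2_pull[OF inj_on_tl_upd])

lemma Rep_truncated_coshift:
  "f \<in> ell2_supp A \<Longrightarrow> Rep_ell2 (truncated_coshift A i w f) \<beta> = Rep_ell2 f (\<beta>(i := w @ \<beta> i))"
  by (simp add: truncated_coshift_def Rep_ell2_pull[OF inj_on_append_upd] ell2_suppD)

lemma cinner_truncated_shift:
  "cinner (truncated_shift A i j f) g = cinner f (truncated_coshift A i [j] g)"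
  unfolding truncated_shift_def truncated_coshift_def
  \<comment> \<open>Deleting the first letter \<open>j\<close> is inverted by prepending it.\<close>
  by (rule cinner_ell2_pull, rule bij_betw_byWitness[where f' = "\<lambda>\<beta>. \<beta>(i := [j] @ \<beta> i)"])
    (auto simp: fun_upd_idem)

section \<open>Multiwords\<close>

text \<open>The index of the vacuum vector; it is \<open>undefined\<close> off
  \<open>{1..k}\<close>, like every member of \<open>multiwords\<close>.\<close>

definition empty_multiword :: "nat \<Rightarrow> nat \<Rightarrow> nat list" where
  "empty_multiword k = (\<lambda>i\<in>{1..k}. [])"

lemma empty_multiword_apply [simp]: "i \<in> {1..k} \<Longrightarrow> empty_multiword k i = []"
  by (simp add: empty_multiword_def)

text \<open>Identifies the coordinate read by the Berezin kernel: the vacuum coordinate after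
  stripping all words of \<open>\<beta>\<close> is the coordinate at \<open>\<beta>\<close>
  itself.\<close>

lemma multiword_append_empty:
  "\<beta> \<in> multiwords k n \<Longrightarrow> (\<lambda>i. if i \<in> {1..k} then \<beta> i @ empty_multiword k i else empty_multiword k i) = \<beta>"
  by (auto simp: multiwords_def PiE_iff extensional_def empty_multiword_def)

lemma multiword_eq_emptyI:
  "\<beta> \<in> multiwords k n \<Longrightarrow> (\<And>i. i \<in> {1..k} \<Longrightarrow> \<beta> i = []) \<Longrightarrow> \<beta> = empty_multiword k"
  by (rule ext) (auto simp: multiwords_def PiE_iff extensional_def empty_multiword_def)

lemma multiword_word: "\<beta> \<in> multiwords k n \<Longrightarrow> i \<in> {1..k} \<Longrightarrow> set (\<beta> i) \<subseteq> {1..n i}"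
  unfolding multiwords_def by (drule PiE_mem) (simp_all add: lists_eq_set)

lemma multiword_hd:
  "\<beta> \<in> multiwords k n \<Longrightarrow> i \<in> {1..k} \<Longrightarrow> \<beta> i \<noteq> [] \<Longrightarrow> hd (\<beta> i) \<in> {1..n i}"
  using multiword_word[of \<beta> k n i] hd_in_set[of "\<beta> i"] by blast

lemma finite_multiwords_level: "finite {\<beta>\<in>multiwords k n. \<forall>i\<in>{1..k}. length (\<beta> i) = q i}"
proof (rule finite_subset)
  show "{\<beta>\<in>multiwords k n. \<forall>i\<in>{1..k}. length (\<beta> i) = q i}
      \<subseteq> (\<Pi>\<^sub>E i\<in>{1..k}. {w. set w \<subseteq> {1..n i} \<and> length w = q i})"
    by (auto simp del: atLeastAtMost_iff simp: multiwords_def lists_eq_set PiE_iff extensional_def)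
  show "finite (\<Pi>\<^sub>E i\<in>{1..k}. {w. set w \<subseteq> {1..n i} \<and> length w = q i})"
    by (intro finite_PiE finite_lists_length_eq) simp_all
qed

lemma multiword_tl:
  assumes "\<beta> \<in> multiwords k n" "i \<in> {1..k}"
  shows "\<beta>(i := tl (\<beta> i)) \<in> multiwords k n"
proof -
  have "tl w \<in> lists S" if "w \<in> lists S" for w and S :: "nat set"
    using that by (cases w) auto
  with assms show ?thesis by (simp add: multiwords_def PiE_iff extensional_def)
qed

section \<open>Truncated shifts as pure rank one elements of the polyball\<close>

locale suffix_closed =
  fixes k :: nat and n :: "nat \<Rightarrow> nat" and A :: "(nat \<Rightarrow> nat list) set"
  assumes multiwords: "A \<subseteq> multiwords k n"
    and empty_mem: "empty_multiword k \<in> A"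
    and tl_mem: "\<beta> \<in> A \<Longrightarrow> i \<in> {1..k} \<Longrightarrow> \<beta>(i := tl (\<beta> i)) \<in> A"
begin

abbreviation H :: "(nat \<Rightarrow> nat list, complex) ell2 set" where "H \<equiv> ell2_supp A"
abbreviation vac :: "(nat \<Rightarrow> nat list, complex) ell2" where "vac \<equiv> ell2_single (empty_multiword k) 1"

text \<open>Read contrapositively: prepending letters to a multiword outside \<open>A\<close> stays
  outside \<open>A\<close>. Hence the coshifts map \<open>H\<close> into itself.\<close>

lemma suffix_mem: "\<beta>(i := w @ \<beta> i) \<in> A \<Longrightarrow> i \<in> {1..k} \<Longrightarrow> \<beta> \<in> A"
proof (induction w)
  case (Cons j w)
  have "(\<beta>(i := (j # w) @ \<beta> i))(i := tl ((\<beta>(i := (j # w) @ \<beta> i)) i)) = \<beta>(i := w @ \<beta> i)" by simp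
  then show ?case using tl_mem[OF Cons.prems] Cons.IH Cons.prems(2) by metis
qed simp

lemma vac_mem: "vac \<in> H"
  using empty_mem by (auto simp: ell2_supp_def ell2_single.rep_eq)

lemma truncated_coshift_mem:
  "i \<in> {1..k} \<Longrightarrow> f \<in> H \<Longrightarrow> truncated_coshift A i w f \<in> H"
  by (rule ell2_suppI) (metis Rep_truncated_coshift ell2_suppD suffix_mem)

text \<open>The first letter of \<open>w\<close> belongs to the outermost factor of
  \<open>word_op\<close>, so the adjoint strips it first and then the remaining word.\<close>

lemma cinner_word_op_truncated_shift:
  assumes "i \<in> {1..k}" "g \<in> H"
  shows "cinner (word_op (truncated_shift A i) w f) g = cinner f (truncated_coshift A i w g)"
  using assms(2)
proof (induction w arbitrary: g)
  case Nil
  have "truncated_coshift A i [] g = g"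
    using Nil by (intro ell2_eqI) (simp add: Rep_truncated_coshift)
  then show ?case by (simp add: word_op_def)
next
  case (Cons j w)
  have "truncated_coshift A i w (truncated_coshift A i [j] g) = truncated_coshift A i (j # w) g"
    using Cons.prems assms(1) by (intro ell2_eqI) (simp add: Rep_truncated_coshift truncated_coshift_mem)
  then show ?case
    using Cons.IH[OF truncated_coshift_mem[OF assms(1) Cons.prems, of "[j]"]]
    by (simp add: word_op_def cinner_truncated_shift)
qed

lemma adj_op_word_op:
  "i \<in> {1..k} \<Longrightarrow> g \<in> H \<Longrightarrow>
    adj_op H H (word_op (truncated_shift A i) w) g = truncated_coshift A i w g"
  by (rule adj_op_eqI[OF subspace_ell2_supp])
    (simp_all only: truncated_coshift_mem cinner_word_op_truncated_shift)

lemma adj_op_truncated_shift: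
  "i \<in> {1..k} \<Longrightarrow> g \<in> H \<Longrightarrow> adj_op H H (truncated_shift A i j) g = truncated_coshift A i [j] g"
  by (rule adj_op_eqI[OF subspace_ell2_supp])
    (simp_all only: truncated_coshift_mem cinner_truncated_shift)

lemma hd_mem: "\<beta> \<in> A \<Longrightarrow> i \<in> {1..k} \<Longrightarrow> \<beta> i \<noteq> [] \<Longrightarrow> hd (\<beta> i) \<in> {1..n i}"
  using multiwords multiword_hd by blast

text \<open>\<open>Phi\<close> maps coordinate projections to coordinate projections: stripping a
  letter \<open>j\<close>, testing membership in \<open>B\<close> and prepending \<open>j\<close>
  again keeps exactly the multiwords that begin with \<open>j\<close> and have their remainder in
  \<open>B\<close>. Everything about defects and purity thereby becomes combinatorics of
  multiwords.\<close>

lemma Phi_ell2_restrict: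
  assumes i: "i \<in> {1..k}" and Y: "\<And>f. f \<in> H \<Longrightarrow> Y f = ell2_restrict B f" and f: "f \<in> H"
  shows "Phi H (n i) (truncated_shift A i) Y f =
    ell2_restrict {\<beta>. \<beta> i \<noteq> [] \<and> \<beta>(i := tl (\<beta> i)) \<in> B} f"
proof (rule ell2_eqI)
  fix \<beta> :: "nat \<Rightarrow> nat list"
  let ?b = "\<beta>(i := tl (\<beta> i))"
  have "?b(i := [hd (\<beta> i)] @ ?b i) = \<beta>" if "\<beta> i \<noteq> []" using that by (simp add: fun_upd_idem)
  then have "Rep_ell2 (truncated_shift A i j (Y (adj_op H H (truncated_shift A i j) f))) \<beta> =
      (if j = hd (\<beta> i) then if \<beta> \<in> A \<and> \<beta> i \<noteq> [] \<and> ?b \<in> B then Rep_ell2 f \<beta> else 0 else 0)" for j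
    unfolding adj_op_truncated_shift[OF i f] Y[OF truncated_coshift_mem[OF i f]]
      Rep_truncated_shift ell2_restrict.rep_eq Rep_truncated_coshift[OF f] by auto
  \<comment> \<open>Only the summand for the first letter of \<open>\<beta> i\<close>
    survives.\<close>
  then have "Rep_ell2 (Phi H (n i) (truncated_shift A i) Y f) \<beta> =
      (if hd (\<beta> i) \<in> {1..n i} then if \<beta> \<in> A \<and> \<beta> i \<noteq> [] \<and> ?b \<in> B then Rep_ell2 f \<beta> else 0 else 0)"
    by (simp add: Phi_def Rep_ell2_sum)
  then show "Rep_ell2 (Phi H (n i) (truncated_shift A i) Y f) \<beta> =
      Rep_ell2 (ell2_restrict {\<beta>. \<beta> i \<noteq> [] \<and> \<beta>(i := tl (\<beta> i)) \<in> B} f) \<beta>"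
    using i f hd_mem[of \<beta> i] by (auto simp: ell2_restrict.rep_eq ell2_suppD)
qed

text \<open>Each factor with exponent 1 removes the multiwords whose word in that coordinate is
  nonempty. The claim is proved for every duplicate-free list of coordinates, to follow the
  \<open>foldr\<close>.\<close>

lemma defect_map_ell2_restrict:
  assumes p: "\<And>i. i \<in> {1..k} \<Longrightarrow> p i \<in> {0, 1}" and f: "f \<in> H"
  shows "defect_map k n H p (truncated_shift A) (\<lambda>h. h) f =
    ell2_restrict {\<beta>. \<forall>i\<in>{1..k}. p i = 1 \<longrightarrow> \<beta> i = []} f"
proof -
  have "foldr (\<lambda>i. id_minus_Phi H (n i) (truncated_shift A i) ^^ p i) L (\<lambda>h. h) f =
    ell2_restrict {\<beta>. \<forall>i\<in>set L. p i = 1 \<longrightarrow> \<beta> i = []} f"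
    if "distinct L" "set L \<subseteq> {1..k}" "f \<in> H" for L f
    using that
  proof (induction L arbitrary: f)
    case Nil
    show ?case by (intro ell2_eqI) (simp add: ell2_restrict.rep_eq)
  next
    case (Cons i L)
    let ?Y = "foldr (\<lambda>i. id_minus_Phi H (n i) (truncated_shift A i) ^^ p i) L (\<lambda>h. h)"
    have i: "i \<in> {1..k}" "i \<notin> set L" using Cons.prems by auto
    have IH: "?Y f = ell2_restrict {\<beta>. \<forall>i\<in>set L. p i = 1 \<longrightarrow> \<beta> i = []} f" if "f \<in> H" for f
      using Cons that by simp
    show ?case
    proof (cases "p i = 0")
      case True
      then show ?thesis using IH[OF Cons.prems(3)] by simp
    next
      case False
      then have pi: "p i = 1" using p[OF i(1)] by simp
      then have "foldr (\<lambda>i. id_minus_Phi H (n i) (truncated_shift A i) ^^ p i) (i # L) (\<lambda>h. h) f =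
          ?Y f - Phi H (n i) (truncated_shift A i) ?Y f"
        by (simp add: id_minus_Phi_def[of H "n i" "truncated_shift A i" ?Y])
      moreover have "Phi H (n i) (truncated_shift A i) ?Y f = ell2_restrict {\<beta>. \<beta> i \<noteq> [] \<and>
          \<beta>(i := tl (\<beta> i)) \<in> {\<beta>. \<forall>i\<in>set L. p i = 1 \<longrightarrow> \<beta> i = []}} f"
        by (rule Phi_ell2_restrict[OF i(1) IH Cons.prems(3)])
      ultimately have eq: "foldr (\<lambda>i. id_minus_Phi H (n i) (truncated_shift A i) ^^ p i) (i # L) (\<lambda>h. h) f =
          ell2_restrict {\<beta>. \<forall>i\<in>set L. p i = 1 \<longrightarrow> \<beta> i = []} f - ell2_restrict {\<beta>. \<beta> i \<noteq> [] \<and>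
          \<beta>(i := tl (\<beta> i)) \<in> {\<beta>. \<forall>i\<in>set L. p i = 1 \<longrightarrow> \<beta> i = []}} f"
        by (simp only: IH[OF Cons.prems(3)])
      \<comment> \<open>Since \<open>i\<close> is not in \<open>L\<close>, the conditions from
        \<open>L\<close> are blind to the deletion in coordinate \<open>i\<close>, so the difference
        leaves exactly the case \<open>\<beta> i = []\<close>.\<close>
      show ?thesis
        unfolding eq using i(2) pi
        by (intro ell2_eqI) (auto simp: ell2_restrict.rep_eq minus_ell2.rep_eq)
    qed
  qed
  moreover have "set [1..<k+1] = {1..k}" by auto
  ultimately show ?thesis
    using f by (simp only: defect_map_def distinct_upt subset_refl)
qed

text \<open>With all exponents 1 only the multiwords with all words empty remain, and by
  extensionality the vacuum index is the only one in \<open>A\<close>.\<close>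

lemma defect_op_truncated_shift:
  assumes "f \<in> H"
  shows "defect_op k n H (truncated_shift A) f = cinner f vac *\<^sub>C vac"
proof -
  have "\<beta> = empty_multiword k" if "\<beta> \<in> A" "\<forall>i\<in>{1..k}. \<beta> i = []" for \<beta>
    using that multiwords by (blast intro: multiword_eq_emptyI)
  then have 0: "Rep_ell2 f \<beta> = 0" if "\<forall>i\<in>{1..k}. \<beta> i = []" "\<beta> \<noteq> empty_multiword k" for \<beta>
    using that ell2_suppD[OF assms] by blast
  have "defect_op k n H (truncated_shift A) f = ell2_restrict {\<beta>. \<forall>i\<in>{1..k}. \<beta> i = []} f"
    using defect_map_ell2_restrict[OF _ assms, of "\<lambda>_. 1"] by (simp add: defect_op_def)
  then show ?thesis
    by (intro ell2_eqI) (auto simp: ell2_restrict.rep_eq scaleC_ell2.rep_eq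
        ell2_single.rep_eq cinner_ell2_single scaleC_complex_def 0 simp del: atLeastAtMost_iff)
qed

text \<open>Both sides read \<open>f\<close> where the two first letters are deleted; closure of
  \<open>A\<close> under deletion makes the intermediate membership tests agree.\<close>

lemma truncated_shift_commute:
  assumes "s \<in> {1..k}" "t \<in> {1..k}" "s \<noteq> t"
  shows "truncated_shift A s j (truncated_shift A t l f) = truncated_shift A t l (truncated_shift A s j f)"
  using assms tl_mem by (intro ell2_eqI) (auto simp: Rep_truncated_shift fun_upd_twist)

lemma bounded_op_truncated_shift: "bounded_op H H (truncated_shift A i j)"
  unfolding truncated_shift_def by (intro bounded_op_ell2_pull inj_on_tl_upd) auto

lemma truncated_shift_regular_polyball: "truncated_shift A \<in> regular_polyball k n H"
proof -
  have "positive_op H (defect_map k n H p (truncated_shift A) (\<lambda>h. h))"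
    if "\<forall>i\<in>{1..k}. p i \<in> {0, 1}" for p
    by (rule positive_op_ell2_restrict[OF defect_map_ell2_restrict]) (use that in blast)+
  then show ?thesis
    by (simp add: regular_polyball_def truncated_shift_commute bounded_op_truncated_shift)
qed

text \<open>The \<open>q\<close>-th iterate of \<open>Phi\<close> at the identity projects onto the
  multiwords whose \<open>i\<close>-th word has length at least \<open>q\<close>. Every fixed
  multiword eventually drops out, so the convergence is even strong.\<close>

lemma pure_truncated_shift: "pure_tuple k n H (truncated_shift A)"
  unfolding pure_tuple_def
proof (intro ballI)
  fix i and f g :: "(nat \<Rightarrow> nat list, complex) ell2" assume i: "i \<in> {1..k}" and f: "f \<in> H"
  have *: "(Phi H (n i) (truncated_shift A i) ^^ q) (\<lambda>h. h) f = ell2_restrict {\<beta>. q \<le> length (\<beta> i)} f"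
    if "f \<in> H" for q f
    using that
  proof (induction q arbitrary: f)
    case 0
    show ?case by (intro ell2_eqI) (simp add: ell2_restrict.rep_eq)
  next
    case (Suc q)
    have "\<beta> i \<noteq> [] \<and> q \<le> length (\<beta> i) - Suc 0 \<longleftrightarrow> Suc q \<le> length (\<beta> i)" for \<beta> :: "nat \<Rightarrow> nat list"
      by (cases "\<beta> i") auto
    then show ?case using Phi_ell2_restrict[OF i Suc.IH Suc.prems] by simp
  qed
  have "\<forall>\<^sub>F q in sequentially. \<beta> \<notin> {\<beta>. q \<le> length (\<beta> i)}" for \<beta> :: "nat \<Rightarrow> nat list"
    using eventually_gt_at_top[of "length (\<beta> i)"] by eventually_elim simp
  from ell2_restrict_tendsto_0[OF this]
  \<comment> \<open>The factor 2 is the constant in \<open>norm_cinner_le\<close>.\<close>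
  have "(\<lambda>q. 2 * (norm (ell2_restrict {\<beta>. q \<le> length (\<beta> i)} f) * norm g)) \<longlonglongrightarrow> 2 * (norm (0 :: (nat \<Rightarrow> nat list, complex) ell2) * norm g)"
    by (intro tendsto_intros)
  then have lim: "(\<lambda>q. 2 * (norm (ell2_restrict {\<beta>. q \<le> length (\<beta> i)} f) * norm g)) \<longlonglongrightarrow> 0"
    by simp
  show "(\<lambda>q. cinner ((Phi H (n i) (truncated_shift A i) ^^ q) (\<lambda>h. h) f) g) \<longlonglongrightarrow> 0"
    unfolding *[OF f] by (rule Lim_null_comparison[OF _ lim]) (intro always_eventually allI norm_cinner_le)
qed

lemma polyball_rank_truncated_shift: "polyball_rank k n H (truncated_shift A) = 1"
proof -
  let ?D = "defect_op k n H (truncated_shift A)"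
  have "?D ` H = complex_vector.span {vac}"
  proof
    show "?D ` H \<subseteq> complex_vector.span {vac}"
      by (auto simp: defect_op_truncated_shift complex_vector.span_singleton)
    have "c *\<^sub>C vac \<in> ?D ` H" for c
      using complex_vector.subspace_scale[OF subspace_ell2_supp vac_mem, of c]
      by (intro image_eqI[of _ _ "c *\<^sub>C vac"])
        (simp_all add: defect_op_truncated_shift cinner_scaleC_left cinner_self norm_ell2_single)
    then show "complex_vector.span {vac} \<subseteq> ?D ` H"
      by (auto simp: complex_vector.span_singleton)
  qed
  moreover have "vac \<noteq> 0"
    using norm_ell2_single[of "empty_multiword k"] by force
  then have "complex_vector.dim (complex_vector.span {vac}) = 1"
    by (subst complex_vector.dim_span_eq_card_independent) auto
  ultimately show ?thesis
    unfolding polyball_rank_def rank_op_def by (auto simp: one_enat_def intro!: exI[of _ "{vac}"])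
qed

section \<open>The Berezin kernel and its traces\<close>

lemma sqrt_defect_op:
  "f \<in> H \<Longrightarrow> sqrt_op H (defect_op k n H (truncated_shift A)) f = Rep_ell2 f (empty_multiword k) *\<^sub>C vac"
  by (subst sqrt_op_rank_one[OF subspace_ell2_supp vac_mem norm_ell2_single])
    (simp_all add: defect_op_truncated_shift cinner_ell2_single)

text \<open>Stripping all words of \<open>\<beta>\<close> from \<open>f\<close> leaves the
  coordinate of \<open>f\<close> at \<open>\<beta>\<close> as vacuum coordinate, and the root of the
  defect projects onto the vacuum.\<close>

lemma berezin_kernel_truncated_shift:
  assumes f: "f \<in> H"
  shows "berezin_kernel k n H (truncated_shift A) f = ell2_tensor f vac"
proof -
  let ?co = "\<lambda>\<beta> L. foldr (\<lambda>i. adj_op H H (word_op (truncated_shift A i) (\<beta> i))) L f"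
  \<comment> \<open>Generalised to lists of distinct coordinates: the coordinates in
    \<open>L\<close> have been stripped, the others are untouched. Membership in \<open>H\<close> is
    carried along for the adjoint formula.\<close>
  have co: "?co \<beta> L \<in> H \<and> (\<forall>\<gamma>. Rep_ell2 (?co \<beta> L) \<gamma> = Rep_ell2 f (\<lambda>i. if i \<in> set L then \<beta> i @ \<gamma> i else \<gamma> i))"
    if "distinct L" "set L \<subseteq> {1..k}" for \<beta> L
    using that
  proof (induction L)
    case Nil
    then show ?case using f by simp
  next
    case (Cons i L)
    have i: "i \<in> {1..k}" "i \<notin> set L" using Cons.prems by auto
    have "(\<lambda>l. if l \<in> set L then \<beta> l @ (\<gamma>(i := \<beta> i @ \<gamma> i)) l else (\<gamma>(i := \<beta> i @ \<gamma> i)) l) =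
        (\<lambda>l. if l \<in> set (i # L) then \<beta> l @ \<gamma> l else \<gamma> l)" for \<gamma>
      using i by auto
    then show ?case
      using Cons i by (simp add: adj_op_word_op truncated_coshift_mem Rep_truncated_coshift del: fun_upd_apply)
  qed
  have "sqrt_op H (defect_op k n H (truncated_shift A)) (?co \<beta> [1..<k+1]) = Rep_ell2 (ell2_tensor f vac) \<beta>"
    if "\<beta> \<in> multiwords k n" for \<beta>
  proof -
    have "set [1..<k+1] = {1..k}" by auto
    then show ?thesis
      using co[of "[1..<k+1]" \<beta>] multiword_append_empty[OF that]
      by (simp only: distinct_upt subset_refl sqrt_defect_op ell2_tensor.rep_eq simp_thms)
  qed
  then have "berezin_kernel k n H (truncated_shift A) f =
      (\<Sum>\<^sub>\<infinity>\<beta>\<in>multiwords k n. ell2_single \<beta> (Rep_ell2 (ell2_tensor f vac) \<beta>))"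
    unfolding berezin_kernel_def by (intro infsum_cong) simp
  also have "\<dots> = ell2_tensor f vac"
  proof (intro infsumI has_sum_ell2_single)
    fix \<beta> assume "\<beta> \<notin> multiwords k n"
    then show "Rep_ell2 (ell2_tensor f vac) \<beta> = 0"
      using multiwords ell2_suppD[OF f, of \<beta>] by (auto simp: ell2_tensor.rep_eq)
  qed
  finally show ?thesis .
qed

text \<open>The kernel is the isometry that tensors with the unit vector \<open>vac\<close>, so
  compressing the level projection by it restricts \<open>f\<close> to the part of \<open>A\<close>
  in that level, and the trace counts this part.\<close>

lemma trace_berezin:
  "trace_op H (\<lambda>f. adj_op H (fock_tensor k n (defect_space k n H (truncated_shift A)))
      (berezin_kernel k n H (truncated_shift A))
      (level_proj k n q (berezin_kernel k n H (truncated_shift A) f))) =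
    of_nat (card {\<beta>\<in>A. \<forall>i\<in>{1..k}. length (\<beta> i) = q i})"
proof (rule trace_op_ell2_restrict)
  let ?B = "{\<beta>\<in>A. \<forall>i\<in>{1..k}. length (\<beta> i) = q i}"
  let ?D = "defect_space k n H (truncated_shift A)"
  show "finite ?B"
    by (rule finite_subset[OF _ finite_multiwords_level[of k n q]]) (use multiwords in blast)
  show "?B \<subseteq> A" by blast
  fix f assume f: "f \<in> H"
  \<comment> \<open>Multiples of \<open>vac\<close> must lie in the defect space: outside its
    codomain argument \<open>adj_op\<close> takes the default value 0.\<close>
  have D: "c *\<^sub>C vac \<in> ?D" for c
  proof -
    have "c *\<^sub>C vac \<in> H" by (intro complex_vector.subspace_scale[OF subspace_ell2_supp] vac_mem)
    moreover from this have "c *\<^sub>C vac = defect_op k n H (truncated_shift A) (c *\<^sub>C vac)"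
      by (simp add: defect_op_truncated_shift cinner_scaleC_left cinner_self norm_ell2_single)
    ultimately have "c *\<^sub>C vac \<in> defect_op k n H (truncated_shift A) ` H" by (rule rev_image_eqI)
    then show ?thesis
      unfolding defect_space_def by (rule closure_subset[THEN subsetD])
  qed
  have lev: "level_proj k n q (ell2_tensor f vac) = ell2_tensor (ell2_restrict ?B f) vac"
    using f multiwords by (intro ell2_eqI)
      (auto simp: level_proj_def ell2_restrict.rep_eq ell2_tensor.rep_eq ell2_suppD)
  have "ell2_restrict ?B f \<in> H" using f by (rule ell2_restrict_supp)
  moreover have "ell2_tensor (ell2_restrict ?B f) vac \<in> fock_tensor k n ?D"
    using D multiwords by (auto simp: fock_tensor_def ell2_tensor.rep_eq ell2_restrict.rep_eq)
  ultimately show "adj_op H (fock_tensor k n ?D) (berezin_kernel k n H (truncated_shift A))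
      (level_proj k n q (berezin_kernel k n H (truncated_shift A) f)) = ell2_restrict ?B f"
    using f by (intro adj_op_eqI subspace_ell2_supp)
      (simp_all add: berezin_kernel_truncated_shift lev cinner_ell2_tensor cinner_self norm_ell2_single)
qed

end

lemma trace_level_proj:
  "trace_op (fock_tensor k n (UNIV :: complex set)) (level_proj k n q) =
    of_nat (card {\<beta>\<in>multiwords k n. \<forall>i\<in>{1..k}. length (\<beta> i) = q i})"
proof -
  have "fock_tensor k n (UNIV :: complex set) = ell2_supp (multiwords k n)"
    by (auto simp: fock_tensor_def ell2_supp_def)
  then show ?thesis
    by (simp only: level_proj_def) (rule trace_op_ell2_restrict[OF finite_multiwords_level]; blast)
qed

section \<open>The set is a unitary invariant\<close>

text \<open>Restricting the unit vectors to \<open>A\<close> makes one formula cover both cases: for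
  \<open>\<beta>\<close> outside \<open>A\<close> both sides vanish, even if the shortened multiword
  lies in \<open>A\<close>.\<close>

lemma (in suffix_closed) truncated_shift_single:
  assumes "i \<in> {1..k}" "\<beta> i \<noteq> []"
  shows "truncated_shift A i (hd (\<beta> i)) (ell2_restrict A (ell2_single (\<beta>(i := tl (\<beta> i))) 1)) =
    ell2_restrict A (ell2_single \<beta> 1)"
proof (rule ell2_eqI)
  fix \<gamma>
  show "Rep_ell2 (truncated_shift A i (hd (\<beta> i)) (ell2_restrict A (ell2_single (\<beta>(i := tl (\<beta> i))) 1))) \<gamma> =
    Rep_ell2 (ell2_restrict A (ell2_single \<beta> 1)) \<gamma>"
  proof (cases "\<gamma> = \<beta>")
    case True
    show ?thesis
      unfolding True Rep_truncated_shift ell2_restrict.rep_eq ell2_single.rep_eq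
      using tl_mem[of \<beta> i] assms by (cases "\<beta> \<in> A") (simp_all del: fun_upd_apply)
  next
    case False
    have *: "\<gamma>(i := tl (\<gamma> i)) \<noteq> \<beta>(i := tl (\<beta> i))" if "\<gamma> i \<noteq> []" "hd (\<gamma> i) = hd (\<beta> i)"
      using tl_upd_inject[of \<gamma> i \<beta>] assms False that by blast
    have "Rep_ell2 (ell2_restrict A (ell2_single (\<beta>(i := tl (\<beta> i))) (1::complex))) (\<gamma>(i := tl (\<gamma> i))) = 0"
      if "\<gamma> i \<noteq> []" "hd (\<gamma> i) = hd (\<beta> i)"
      unfolding ell2_restrict.rep_eq ell2_single.rep_eq if_not_P[OF *[OF that]] by (rule if_cancel)
    then show ?thesis
      unfolding Rep_truncated_shift
      by (metis (no_types, lifting) False ell2_restrict.rep_eq ell2_single.rep_eq)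
  qed
qed

text \<open>The vacuum is orthogonal to the ranges of all shifts, so \<open>U\<close> maps it to a
  multiple \<open>c\<close> of the vacuum. Applying shifts letter by letter, \<open>U\<close> sends
  each restricted unit vector for \<open>A\<close> to \<open>c\<close> times the one for
  \<open>B\<close>, and one vanishes exactly when the other does.\<close>

lemma truncated_shift_unitarily_equivalent_imp_eq:
  assumes "suffix_closed k n A" "suffix_closed k n B"
    and "unitarily_equivalent k n (ell2_supp A) (truncated_shift A) (ell2_supp B) (truncated_shift B)"
  shows "A = B"
proof -
  interpret A: suffix_closed k n A by fact
  interpret B: suffix_closed k n B by fact
  let ?S = "\<lambda>\<beta>. ell2_single \<beta> (1::complex)"
  obtain U where U: "unitary_op (ell2_supp A) (ell2_supp B) U"
    and int: "\<And>i j h. i \<in> {1..k} \<Longrightarrow> j \<in> {1..n i} \<Longrightarrow> h \<in> ell2_supp A \<Longrightarrow>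
      U (truncated_shift A i j h) = truncated_shift B i j (U h)"
    using assms(3) by (auto simp: unitarily_equivalent_def)
  have iso: "cinner (U x) (U y) = cinner x y" if "x \<in> ell2_supp A" "y \<in> ell2_supp A" for x y
    using U that by (simp add: unitary_op_def)
  have surj: "U ` ell2_supp A = ell2_supp B" using U by (simp add: unitary_op_def)
  define u where "u = U A.vac"
  have u: "u \<in> ell2_supp B" using surj A.vac_mem by (auto simp: u_def)
  have restrict_mem: "ell2_restrict C (?S \<beta>) \<in> ell2_supp C" for C \<beta>
    by (simp add: ell2_supp_def ell2_restrict.rep_eq)
  \<comment> \<open>By surjectivity of \<open>U\<close>, the unit vector at a nonempty
    \<open>\<beta>\<close> is the image under \<open>U\<close> of a vector in the range of a shift,
    which is orthogonal to the vacuum.\<close>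
  have Rep_u: "Rep_ell2 u \<beta> = 0" if \<beta>: "\<beta> \<in> B" "\<beta> \<noteq> empty_multiword k" for \<beta>
  proof -
    obtain i where i: "i \<in> {1..k}" "\<beta> i \<noteq> []"
      using \<beta> B.multiwords multiword_eq_emptyI[of \<beta> k n] by blast
    let ?j = "hd (\<beta> i)"
    have "ell2_restrict B (?S (\<beta>(i := tl (\<beta> i)))) \<in> U ` ell2_supp A"
      unfolding surj by (rule restrict_mem)
    then obtain g where g: "g \<in> ell2_supp A" "U g = ell2_restrict B (?S (\<beta>(i := tl (\<beta> i))))"
      by (metis imageE)
    have "Rep_ell2 u \<beta> = cinner u (ell2_restrict B (?S \<beta>))"
    proof -
      have "ell2_restrict B (?S \<beta>) = ?S \<beta>"
        using \<beta>(1) by (intro ell2_eqI) (auto simp: ell2_restrict.rep_eq ell2_single.rep_eq)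
      then show ?thesis by (simp add: cinner_ell2_single)
    qed
    also have "\<dots> = cinner u (U (truncated_shift A i ?j g))"
      using int[OF i(1) B.hd_mem[OF \<beta>(1) i] g(1)] g(2) B.truncated_shift_single[of i \<beta>, OF i] by simp
    also have "\<dots> = cinner A.vac (truncated_shift A i ?j g)"
      unfolding u_def using A.bounded_op_truncated_shift g(1)
      by (intro iso A.vac_mem) (auto simp: bounded_op_def)
    also have "\<dots> = 0"
      using i by (subst cinner_commute) (simp add: cinner_ell2_single Rep_truncated_shift)
    finally show ?thesis .
  qed
  define c where "c = Rep_ell2 u (empty_multiword k)"
  have uc: "u = c *\<^sub>C A.vac"
  proof (rule ell2_eqI)
    fix \<beta> show "Rep_ell2 u \<beta> = Rep_ell2 (c *\<^sub>C A.vac) \<beta>"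
      using Rep_u[of \<beta>] ell2_suppD[OF u, of \<beta>]
      by (auto simp: c_def scaleC_ell2.rep_eq ell2_single.rep_eq scaleC_complex_def)
  qed
  have "cinner u u = 1"
    unfolding u_def iso[OF A.vac_mem A.vac_mem] by (simp add: cinner_self norm_ell2_single)
  then have c: "c \<noteq> 0" by (auto simp: uc)
  have U_single: "U (ell2_restrict A (?S \<beta>)) = c *\<^sub>C ell2_restrict B (?S \<beta>)" if "\<beta> \<in> multiwords k n" for \<beta>
    using that
  \<comment> \<open>Induction on the total length; one step deletes the first letter of some
    nonempty word.\<close>
  proof (induction "\<Sum>i=1..k. length (\<beta> i)" arbitrary: \<beta> rule: less_induct)
    case less
    show ?case
    proof (cases "\<beta> = empty_multiword k")
      case True
      then have "ell2_restrict A (?S \<beta>) = A.vac" "ell2_restrict B (?S \<beta>) = A.vac"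
        using A.empty_mem B.empty_mem
        by (intro ell2_eqI; auto simp: ell2_restrict.rep_eq ell2_single.rep_eq)+
      then show ?thesis using uc by (simp add: u_def)
    next
      case False
      then obtain i where i: "i \<in> {1..k}" "\<beta> i \<noteq> []"
        using less.prems multiword_eq_emptyI[of \<beta> k n] by blast
      let ?b = "\<beta>(i := tl (\<beta> i))"
      have "(\<Sum>i=1..k. length (?b i)) < (\<Sum>i=1..k. length (\<beta> i))"
        by (rule sum_strict_mono_ex1) (use i in auto)
      moreover have "?b \<in> multiwords k n"
        using less.prems i by (intro multiword_tl)
      ultimately have IH: "U (ell2_restrict A (?S ?b)) = c *\<^sub>C ell2_restrict B (?S ?b)"
        by (rule less.hyps)
      have j: "hd (\<beta> i) \<in> {1..n i}"
        using less.prems i by (intro multiword_hd)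
      have "U (ell2_restrict A (?S \<beta>)) = U (truncated_shift A i (hd (\<beta> i)) (ell2_restrict A (?S ?b)))"
        by (simp add: A.truncated_shift_single[of i \<beta>, OF i])
      also have "\<dots> = truncated_shift B i (hd (\<beta> i)) (c *\<^sub>C ell2_restrict B (?S ?b))"
        by (simp only: int[OF i(1) j restrict_mem] IH)
      also have "\<dots> = c *\<^sub>C truncated_shift B i (hd (\<beta> i)) (ell2_restrict B (?S ?b))"
        by (simp only: truncated_shift_def ell2_pull_scaleC)
      finally show ?thesis by (simp only: B.truncated_shift_single[of i \<beta>, OF i])
    qed
  qed
  have "\<beta> \<in> A \<longleftrightarrow> \<beta> \<in> B" if "\<beta> \<in> multiwords k n" for \<beta>
  proof -
    have 0: "cinner (ell2_restrict C (?S \<beta>)) (ell2_restrict C (?S \<beta>)) = (if \<beta> \<in> C then 1 else 0)" for C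
    proof -
      have "ell2_restrict C (?S \<beta>) = (if \<beta> \<in> C then ?S \<beta> else 0)"
        by (intro ell2_eqI) (auto simp: ell2_restrict.rep_eq ell2_single.rep_eq zero_ell2.rep_eq)
      then show ?thesis by (simp add: cinner_self norm_ell2_single)
    qed
    \<comment> \<open>Isometry compares the squared norms, which are 1 or 0 according to membership
      of \<open>\<beta>\<close>.\<close>
    have "cnj c * (c * (if \<beta> \<in> B then 1 else 0)) = (if \<beta> \<in> A then 1 else 0)"
      using iso[OF restrict_mem restrict_mem, of \<beta> \<beta>]
      unfolding U_single[OF that] cinner_scaleC_left cinner_scaleC_right 0 .
    then show ?thesis using c by (auto split: if_splits)
  qed
  then show ?thesis using A.multiwords B.multiwords by blast
qed

section \<open>Averages over a simplex\<close>

text \<open>For \<open>I = {1..k}\<close> this is the index set of the sum in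
  \<open>curvature\<close>; a general \<open>I\<close> permits induction on the coordinates.\<close>

definition nat_simplex :: "nat set \<Rightarrow> nat \<Rightarrow> (nat \<Rightarrow> nat) set" where
  "nat_simplex I m = {q. q \<in> extensional I \<and> (\<Sum>i\<in>I. q i) \<le> m}"

lemma finite_nat_simplex:
  assumes "finite I"
  shows "finite (nat_simplex I m)"
proof (rule finite_subset)
  show "nat_simplex I m \<subseteq> (\<Pi>\<^sub>E i\<in>I. {..m})"
  proof
    fix q assume q: "q \<in> nat_simplex I m"
    then have "q i \<le> m" if "i \<in> I" for i
      using member_le_sum[of i I q] that assms by (simp add: nat_simplex_def)
    then show "q \<in> (\<Pi>\<^sub>E i\<in>I. {..m})"
      using q by (auto simp: nat_simplex_def PiE_iff)
  qed
  show "finite (\<Pi>\<^sub>E i\<in>I. {..m})" using assms by (intro finite_PiE) auto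
qed

text \<open>Slicing by the value \<open>r\<close> of the coordinate \<open>i\<close>, which leaves
  the budget \<open>m - r\<close> for the others.\<close>

lemma sum_nat_simplex_insert:
  fixes g :: "(nat \<Rightarrow> nat) \<Rightarrow> 'a::comm_monoid_add"
  assumes I: "finite I" "i \<notin> I"
  shows "(\<Sum>q\<in>nat_simplex (insert i I) m. g q) = (\<Sum>r\<le>m. \<Sum>q\<in>nat_simplex I (m - r). g (q(i := r)))"
proof -
  have upd: "(\<Sum>l\<in>I. (q(i := r)) l) = (\<Sum>l\<in>I. q l)" for q and r :: nat
    using I by (intro sum.cong) auto
  have "(\<Sum>r\<le>m. \<Sum>q\<in>nat_simplex I (m - r). g (q(i := r))) =
      (\<Sum>(r, q)\<in>Sigma {..m} (\<lambda>r. nat_simplex I (m - r)). g (q(i := r)))"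
    using I by (intro sum.Sigma) (auto simp: finite_nat_simplex)
  also have "\<dots> = (\<Sum>q\<in>nat_simplex (insert i I) m. g q)"
  \<comment> \<open>Forgetting the coordinate \<open>i\<close> resets it to
    \<open>undefined\<close>, as membership in \<open>extensional I\<close> demands.\<close>
  proof (rule sum.reindex_bij_witness[of _ "\<lambda>q. (q i, q(i := undefined))" "\<lambda>(r, q). q(i := r)"])
    fix a assume a: "a \<in> Sigma {..m} (\<lambda>r. nat_simplex I (m - r))"
    then obtain r q where rq: "a = (r, q)" "r \<le> m" "q \<in> extensional I" "(\<Sum>l\<in>I. q l) \<le> m - r"
      by (auto simp: nat_simplex_def)
    show "(case case a of (r, q) \<Rightarrow> q(i := r) of q \<Rightarrow> (q i, q(i := undefined))) = a"
      using rq I by (auto simp: extensional_def)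
    show "(case a of (r, q) \<Rightarrow> q(i := r)) \<in> nat_simplex (insert i I) m"
      using rq I upd[of q r] by (auto simp: nat_simplex_def extensional_def)
    show "g (case a of (r, q) \<Rightarrow> q(i := r)) = (case a of (r, q) \<Rightarrow> g (q(i := r)))"
      by (simp add: rq)
  next
    fix q assume "q \<in> nat_simplex (insert i I) m"
    then show "(q i, q(i := undefined)) \<in> Sigma {..m} (\<lambda>r. nat_simplex I (m - r))"
      using I upd[of q undefined] by (auto simp: nat_simplex_def extensional_def)
  qed simp
  finally show ?thesis by simp
qed

text \<open>Stars and bars, by slicing and the hockey-stick identity for the sum of the
  slices.\<close>

lemma card_nat_simplex:
  assumes "finite I"
  shows "card (nat_simplex I m) = (m + card I) choose card I"
  using assms
proof (induction I arbitrary: m rule: finite_induct)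
  case empty
  have "nat_simplex {} m = {\<lambda>_. undefined}" by (auto simp: nat_simplex_def)
  then show ?case by simp
next
  case (insert i I)
  have "card (nat_simplex (insert i I) m) = (\<Sum>r\<le>m. (m - r + card I) choose card I)"
    using sum_nat_simplex_insert[OF insert.hyps(1,2), of "\<lambda>_. 1::nat" m] by (simp add: insert.IH)
  also have "\<dots> = (\<Sum>r\<le>m. (card I + r) choose card I)"
    by (rule sum.reindex_bij_witness[of _ "\<lambda>r. m - r" "\<lambda>r. m - r"]) (auto simp: add.commute)
  also have "\<dots> = (m + card (insert i I)) choose card (insert i I)"
    using insert.hyps choose_rising_sum(1)[of "card I" m] by (simp add: add.commute del: binomial_Suc_Suc)
  finally show ?case .
qed

section \<open>Convergence of averages\<close>

text \<open>A Toeplitz summation argument: late terms deviate from \<open>t\<close> by less than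
  \<open>e / 2\<close>, while the finitely many early deviations sum to a constant \<open>C\<close>
  that is multiplied by weights of at most \<open>b m\<close>.\<close>

lemma weighted_average_tendsto:
  fixes d :: "nat \<Rightarrow> real"
  assumes d: "d \<longlonglongrightarrow> t"
    and w0: "\<And>m r. r \<le> m \<Longrightarrow> 0 \<le> w m r" and w1: "\<And>m. (\<Sum>r\<le>m. w m r) = 1"
    and wb: "\<And>m r. r \<le> m \<Longrightarrow> w m r \<le> b m" and b: "b \<longlonglongrightarrow> 0"
  shows "(\<lambda>m. \<Sum>r\<le>m. d r * w m r) \<longlonglongrightarrow> t"
proof (rule LIMSEQ_I)
  fix e :: real assume e: "e > 0"
  obtain R where R: "\<bar>d r - t\<bar> < e / 2" if "r \<ge> R" for r
    using LIMSEQ_D[OF d, of "e / 2"] e by auto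
  define C where "C = (\<Sum>r<R. \<bar>d r - t\<bar>)"
  have "(\<lambda>m. C * b m) \<longlonglongrightarrow> C * 0" by (intro tendsto_intros b)
  then obtain M where M: "\<bar>C * b m\<bar> < e / 2" if "m \<ge> M" for m
    using LIMSEQ_D[of "\<lambda>m. C * b m" 0 "e / 2"] e by auto
  have "norm ((\<Sum>r\<le>m. d r * w m r) - t) < e" if m: "m \<ge> max M R" for m
  proof -
    have "(\<Sum>r\<le>m. d r * w m r) - t = (\<Sum>r\<le>m. d r * w m r) - t * (\<Sum>r\<le>m. w m r)"
      by (simp add: w1)
    also have "\<dots> = (\<Sum>r\<le>m. (d r - t) * w m r)"
      by (simp add: sum_distrib_left left_diff_distrib flip: sum_subtractf)
    also have "\<bar>\<dots>\<bar> \<le> (\<Sum>r\<le>m. \<bar>d r - t\<bar> * w m r)"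
      by (rule order_trans[OF sum_abs]) (auto intro!: sum_mono simp: abs_mult w0)
    also have "\<dots> \<le> (\<Sum>r\<le>m. (if r < R then \<bar>d r - t\<bar> * b m else 0) + e / 2 * w m r)"
    proof (rule sum_mono)
      fix r assume r: "r \<in> {..m}"
      show "\<bar>d r - t\<bar> * w m r \<le> (if r < R then \<bar>d r - t\<bar> * b m else 0) + e / 2 * w m r"
      proof (cases "r < R")
        case True
        have "\<bar>d r - t\<bar> * w m r \<le> \<bar>d r - t\<bar> * b m" "0 \<le> e / 2 * w m r"
          using r e by (auto intro!: mult_left_mono wb mult_nonneg_nonneg w0)
        then show ?thesis using True by simp
      next
        case False
        have "\<bar>d r - t\<bar> * w m r \<le> e / 2 * w m r"
          using r R[of r] False by (intro mult_right_mono w0) auto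
        then show ?thesis using False by simp
      qed
    qed
    also have "\<dots> = (\<Sum>r\<le>m. if r < R then \<bar>d r - t\<bar> * b m else 0) + e / 2"
      unfolding sum.distrib sum_distrib_left[symmetric] w1 by simp
    also have "(\<Sum>r\<le>m. if r < R then \<bar>d r - t\<bar> * b m else 0) = C * b m"
    proof -
      have "(\<Sum>r\<le>m. if r < R then \<bar>d r - t\<bar> * b m else 0) = (\<Sum>r<R. \<bar>d r - t\<bar> * b m)"
        using m by (intro sum.mono_neutral_cong_right) auto
      then show ?thesis by (simp add: C_def sum_distrib_right)
    qed
    finally show ?thesis using M[of m] m by auto
  qed
  then show "\<exists>no. \<forall>m\<ge>no. norm ((\<Sum>r\<le>m. d r * w m r) - t) < e" by blast
qed

text \<open>Slicing along the coordinate \<open>i\<close> makes the average a weighted one, with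
  \<open>w m r\<close> the proportion of the slice at \<open>r\<close>. The slice at 0 is the
  largest, and its proportion is \<open>k / (m + k)\<close>.\<close>

lemma simplex_average_tendsto:
  fixes d :: "nat \<Rightarrow> real"
  assumes d: "d \<longlonglongrightarrow> t" and i: "i \<in> {1..k}"
  shows "(\<lambda>m. (\<Sum>q\<in>nat_simplex {1..k} m. d (q i)) / real ((m + k) choose k)) \<longlonglongrightarrow> t"
proof -
  define I where "I = {1..k} - {i}"
  define c where "c = card I"
  have I: "finite I" "i \<notin> I" "insert i I = {1..k}" using i by (auto simp: I_def)
  have k: "k = Suc c" using I card_insert_disjoint[OF I(1,2)] by (simp add: c_def)
  define w where "w m r = real ((m - r + c) choose c) / real ((m + k) choose k)" for m r
  have pos: "(m + k) choose k > 0" for m by simp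
  have sum: "(\<Sum>q\<in>nat_simplex {1..k} m. d (q i)) = (\<Sum>r\<le>m. d r * real ((m - r + c) choose c))" for d :: "nat \<Rightarrow> real" and m
    using sum_nat_simplex_insert[OF I(1,2), of "\<lambda>q. d (q i)" m]
    by (simp add: I(3) card_nat_simplex[OF I(1)] c_def mult.commute)
  have "(\<lambda>m. \<Sum>r\<le>m. d r * w m r) \<longlonglongrightarrow> t"
  proof (rule weighted_average_tendsto[OF d])
    show "0 \<le> w m r" for m r by (simp add: w_def)
    have "(\<Sum>r\<le>m. real ((m - r + c) choose c)) = real ((m + k) choose k)" for m
      using sum[of "\<lambda>_. 1" m] by (simp add: card_nat_simplex)
    then show "(\<Sum>r\<le>m. w m r) = 1" for m
      using pos[of m] by (simp add: w_def flip: sum_divide_distrib)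
    show "w m r \<le> real k / real (m + k)" if "r \<le> m" for m r
    proof -
      \<comment> \<open>The absorption identity for binomial coefficients, with
        \<open>k = Suc c\<close>.\<close>
      have "k * ((m + k) choose k) = (m + k) * ((m + c) choose c)"
        using Suc_times_binomial[of c "m + c"] by (simp only: k add_Suc_right)
      then have "real k * real ((m + k) choose k) = real (m + k) * real ((m + c) choose c)"
        by (metis of_nat_mult)
      moreover have nz: "real (m + k) \<noteq> 0" "real ((m + k) choose k) \<noteq> 0"
        using pos[of m] by (auto simp: k simp del: binomial_Suc_Suc)
      ultimately have "real k / real (m + k) = real ((m + c) choose c) / real ((m + k) choose k)"
        unfolding frac_eq_eq[OF nz] by (simp only: mult.commute)
      moreover have "(m - r + c) choose c \<le> (m + c) choose c"
        by (intro binomial_right_mono) simp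
      ultimately show ?thesis
        by (simp add: w_def divide_right_mono)
    qed
    show "(\<lambda>m. real k / real (m + k)) \<longlonglongrightarrow> 0"
      by (rule LIMSEQ_ignore_initial_segment[where f = "\<lambda>m. real k / real m"]) (rule lim_const_over_n)
  qed
  then show ?thesis by (simp only: w_def sum sum_divide_distrib times_divide_eq_right)
qed

section \<open>Sets of words of prescribed density\<close>

text \<open>The first letter is the least significant digit, so that deleting it passes to the enclosing
  \<open>N\<close>-adic interval.\<close>

fun word_value :: "nat \<Rightarrow> nat list \<Rightarrow> nat" where
  "word_value N [] = 0"
| "word_value N (j # w) = word_value N w * N + (j - 1)"

text \<open>Uniqueness of base \<open>N\<close> expansions of fixed length, with the letters 1 to
  \<open>N\<close> standing for the digits 0 to \<open>N - 1\<close>.\<close>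

lemma inj_on_word_value: "inj_on (word_value N) {w. set w \<subseteq> {1..N} \<and> length w = q}"
proof (rule inj_onI)
  fix v w assume "v \<in> {w. set w \<subseteq> {1..N} \<and> length w = q}" "w \<in> {w. set w \<subseteq> {1..N} \<and> length w = q}"
    and "word_value N v = word_value N w"
  then show "v = w"
  proof (induction q arbitrary: v w)
    case (Suc q)
    then obtain i v' j w' where vw: "v = i # v'" "w = j # w'" by (auto simp: length_Suc_conv)
    then have ij: "1 \<le> i" "i \<le> N" "1 \<le> j" "j \<le> N" using Suc.prems by auto
    obtain a b where ab: "i = Suc a" "j = Suc b" using ij by (metis One_nat_def Suc_le_D)
    have eq: "word_value N v' * N + a = word_value N w' * N + b"
      using Suc.prems vw ab by simp
    have "a = b"
      using arg_cong[OF eq, of "\<lambda>x. x mod N"] ij ab by simp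
    moreover have "word_value N v' = word_value N w'"
      using arg_cong[OF eq, of "\<lambda>x. x div N"] ij ab by simp
    then have "v' = w'" using Suc.prems vw by (intro Suc.IH) auto
    ultimately show ?case using ab vw by simp
  qed simp
qed

lemma word_value_surj: "x < N ^ q \<Longrightarrow> \<exists>w. set w \<subseteq> {1..N} \<and> length w = q \<and> word_value N w = x"
proof (induction q arbitrary: x)
  case (Suc q)
  then have N: "N > 0" by (cases N) auto
  have "x div N < N ^ q"
    using Suc.prems by (simp add: less_mult_imp_div_less mult.commute)
  then obtain w where w: "set w \<subseteq> {1..N}" "length w = q" "word_value N w = x div N"
    using Suc.IH by blast
  \<comment> \<open>The remainder is the lowest digit, hence the first letter after adding
    1.\<close>
  then show ?case
    using N mod_less_divisor[OF N, of x] by (intro exI[of _ "Suc (x mod N) # w"]) auto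
qed simp

text \<open>For \<open>s < u\<close> and \<open>x = word_value N w\<close>, the inequalities say
  that the \<open>N\<close>-adic interval from \<open>x\<close> to \<open>x + 1\<close>, scaled down
  by \<open>N ^ length w\<close>, meets the open interval from \<open>s\<close> to
  \<open>u\<close>.\<close>

definition interval_words :: "nat \<Rightarrow> real \<Rightarrow> real \<Rightarrow> nat list set" where
  "interval_words N s u = {w. set w \<subseteq> {1..N} \<and> s * real N ^ length w < real (word_value N w) + 1 \<and>
     real (word_value N w) < u * real N ^ length w}"

text \<open>The digit \<open>j - 1\<close> lies between 0 and \<open>N - 1\<close>, so both
  inequalities survive division by \<open>N\<close>.\<close>

lemma interval_words_tl:
  assumes w: "w \<in> interval_words N s u"
  shows "tl w \<in> interval_words N s u"
proof (cases w)
  case (Cons j v)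
  then have j: "1 \<le> j" "j \<le> N" and v: "set v \<subseteq> {1..N}" using w by (auto simp: interval_words_def)
  let ?x = "real (word_value N v)"
  have l: "real N * (s * real N ^ length v) < ?x * real N + real (j - 1) + 1"
    and u: "?x * real N + real (j - 1) < real N * (u * real N ^ length v)"
    using w Cons by (auto simp: interval_words_def algebra_simps)
  have "?x * real N + real (j - 1) + 1 \<le> real N * (?x + 1)"
    using j by (simp add: algebra_simps)
  with l have "real N * (s * real N ^ length v) < real N * (?x + 1)" by linarith
  then have 1: "s * real N ^ length v < ?x + 1" using j by simp
  have "real N * ?x < real N * (u * real N ^ length v)"
    using u by (simp add: mult.commute)
  then have "?x < u * real N ^ length v" using j by simp
  with 1 v show ?thesis by (simp add: Cons interval_words_def)
qed (use w in simp)

text \<open>The values of these words are consecutive integers, and rounding each endpoint costs at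
  most 1.\<close>

lemma card_interval_words_level:
  assumes s: "0 \<le> s" "s \<le> u" "u \<le> 1"
  shows "\<bar>real (card {w \<in> interval_words N s u. length w = q}) - (u - s) * real N ^ q\<bar> \<le> 2"
proof -
  define a b where "a = s * real N ^ q" and "b = u * real N ^ q"
  have ab: "0 \<le> a" "a \<le> b" "b \<le> real (N ^ q)"
    using s mult_right_mono[of u 1 "real N ^ q"] by (auto simp: a_def b_def intro: mult_right_mono)
  have "bij_betw (word_value N) {w \<in> interval_words N s u. length w = q} {nat \<lfloor>a\<rfloor>..<nat \<lceil>b\<rceil>}"
    unfolding bij_betw_def
  proof
    show "inj_on (word_value N) {w \<in> interval_words N s u. length w = q}"
      by (rule inj_on_subset[OF inj_on_word_value[of N q]]) (auto simp: interval_words_def)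
    \<comment> \<open>The strict inequalities of \<open>interval_words\<close> match a floor on the
      left and an excluded ceiling on the right.\<close>
    have mem: "x \<in> {nat \<lfloor>a\<rfloor>..<nat \<lceil>b\<rceil>} \<longleftrightarrow> a < real x + 1 \<and> real x < b" for x
      using ab by (simp add: nat_le_iff zless_nat_eq_int_zless less_ceiling_iff) linarith
    show "word_value N ` {w \<in> interval_words N s u. length w = q} = {nat \<lfloor>a\<rfloor>..<nat \<lceil>b\<rceil>}"
    proof (intro equalityI subsetI)
      fix x assume x: "x \<in> {nat \<lfloor>a\<rfloor>..<nat \<lceil>b\<rceil>}"
      then have "real x < b" unfolding mem by simp
      then have "x < N ^ q" using ab(3) by (metis of_nat_less_iff order_less_le_trans)
      then obtain w where "set w \<subseteq> {1..N}" "length w = q" "word_value N w = x"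
        using word_value_surj[of x N q] by auto
      then show "x \<in> word_value N ` {w \<in> interval_words N s u. length w = q}"
        using x unfolding mem by (intro image_eqI[of _ _ w]) (auto simp: interval_words_def a_def b_def)
    next
      fix x assume "x \<in> word_value N ` {w \<in> interval_words N s u. length w = q}"
      then show "x \<in> {nat \<lfloor>a\<rfloor>..<nat \<lceil>b\<rceil>}"
        unfolding mem by (auto simp: interval_words_def a_def b_def)
    qed
  qed
  then have "card {w \<in> interval_words N s u. length w = q} = nat \<lceil>b\<rceil> - nat \<lfloor>a\<rfloor>"
    by (simp add: bij_betw_same_card)
  moreover have "nat \<lfloor>a\<rfloor> \<le> nat \<lceil>b\<rceil>" using ab by (intro nat_mono) linarith
  ultimately have "real (card {w \<in> interval_words N s u. length w = q}) = of_int \<lceil>b\<rceil> - of_int \<lfloor>a\<rfloor>"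
    using ab by (simp add: of_nat_diff)
  then show ?thesis
    unfolding left_diff_distrib a_def[symmetric] b_def[symmetric] by linarith
qed

lemma interval_words_density:
  assumes "0 \<le> s" "s \<le> u" "u \<le> 1" and N: "N \<ge> 2"
  shows "(\<lambda>q. real (card {w \<in> interval_words N s u. length w = q}) / real N ^ q) \<longlonglongrightarrow> u - s"
proof -
  let ?c = "\<lambda>q. real (card {w \<in> interval_words N s u. length w = q})"
  have "(\<lambda>q. 2 * inverse (real N) ^ q) \<longlonglongrightarrow> 2 * 0"
    using N by (intro tendsto_intros LIMSEQ_power_zero) (auto simp: inverse_less_1_iff)
  then have lim: "(\<lambda>q. 2 * inverse (real N) ^ q) \<longlonglongrightarrow> 0" by simp
  have "norm (?c q / real N ^ q - (u - s)) \<le> 2 * inverse (real N) ^ q" for q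
  proof -
    have "?c q / real N ^ q - (u - s) = (?c q - (u - s) * real N ^ q) / real N ^ q"
      using N by (simp add: field_simps)
    then show ?thesis
      using card_interval_words_level[OF assms(1-3), of N q] N
      by (simp add: abs_mult divide_inverse power_inverse mult_right_mono)
  qed
  then have "(\<lambda>q. ?c q / real N ^ q - (u - s)) \<longlonglongrightarrow> 0"
    by (intro Lim_null_comparison[OF always_eventually lim]) simp
  then show ?thesis by (simp add: LIM_zero_iff)
qed

text \<open>At a level finer than \<open>s' - s\<close>, the interval containing \<open>s\<close>
  reaches beyond \<open>s\<close> but ends before \<open>s'\<close>.\<close>

lemma interval_words_separate:
  assumes s: "0 \<le> s" "s < s'" "s < u" "u \<le> 1" and N: "N \<ge> 2"
  shows "\<exists>w. w \<in> interval_words N s u \<and> w \<notin> interval_words N s' u'"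
proof -
  have "(1::real) < real N" using N by simp
  then obtain q where q: "max (1 / (s' - s)) 1 < real N ^ q" using real_arch_pow by blast
  then have sq: "1 < (s' - s) * real N ^ q" using s by (simp add: field_simps)
  \<comment> \<open>The index of the level \<open>q\<close> interval that contains
    \<open>s\<close>.\<close>
  define x where "x = nat \<lfloor>s * real N ^ q\<rfloor>"
  have x: "real x \<le> s * real N ^ q" "s * real N ^ q < real x + 1"
    using s by (auto simp: x_def)
  have less: "s * real N ^ q < u * real N ^ q" using s N by simp
  have "u * real N ^ q \<le> 1 * real N ^ q" using s by (intro mult_right_mono) auto
  then have "real x < real N ^ q" using x less by linarith
  then have "x < N ^ q" by (metis of_nat_less_iff of_nat_power)
  then obtain w where w: "set w \<subseteq> {1..N}" "length w = q" "word_value N w = x"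
    using word_value_surj[of x N q] by auto
  then have "w \<in> interval_words N s u" using x less by (simp add: interval_words_def)
  moreover have "w \<notin> interval_words N s' u'"
    using w x sq by (auto simp: interval_words_def left_diff_distrib)
  ultimately show ?thesis by blast
qed

section \<open>Fibers over one coordinate and their curvature\<close>

definition fiber :: "nat \<Rightarrow> (nat \<Rightarrow> nat) \<Rightarrow> nat \<Rightarrow> nat list set \<Rightarrow> (nat \<Rightarrow> nat list) set" where
  "fiber k n i W = {\<beta> \<in> multiwords k n. \<beta> i \<in> W}"

lemma suffix_closed_fiber:
  assumes "[] \<in> W" and tl: "\<And>w. w \<in> W \<Longrightarrow> tl w \<in> W" and "i \<in> {1..k}"
  shows "suffix_closed k n (fiber k n i W)"
proof
  show "fiber k n i W \<subseteq> multiwords k n" by (auto simp: fiber_def)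
  show "empty_multiword k \<in> fiber k n i W"
    using assms by (auto simp: fiber_def multiwords_def empty_multiword_def)
  fix \<beta> j assume "\<beta> \<in> fiber k n i W" "j \<in> {1..k}"
  then show "\<beta>(j := tl (\<beta> j)) \<in> fiber k n i W"
    using multiword_tl[of \<beta> k n j] tl by (auto simp: fiber_def)
qed

text \<open>A word is recovered from the multiword that has it in coordinate \<open>i\<close> and
  empty words elsewhere.\<close>

lemma fiber_subset_imp_subset:
  assumes sub: "fiber k n i V \<subseteq> fiber k n i W" and V: "V \<subseteq> lists {1..n i}" and i: "i \<in> {1..k}"
  shows "V \<subseteq> W"
proof
  fix w assume w: "w \<in> V"
  have "(empty_multiword k)(i := w) \<in> multiwords k n"
    using w V i by (auto simp: multiwords_def empty_multiword_def PiE_iff extensional_def)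
  then have "(empty_multiword k)(i := w) \<in> fiber k n i V" using w by (simp add: fiber_def)
  then have "(empty_multiword k)(i := w) \<in> fiber k n i W" using sub by blast
  then show "w \<in> W" by (simp add: fiber_def)
qed

text \<open>A level of the fiber is a product of independent coordinates, of which only the
  \<open>i\<close>-th is constrained by \<open>W\<close>.\<close>

lemma card_fiber_level:
  assumes i: "i \<in> {1..k}" and W: "W \<subseteq> lists {1..n i}"
  shows "card {\<beta> \<in> fiber k n i W. \<forall>l\<in>{1..k}. length (\<beta> l) = q l} =
    card {w \<in> W. length w = q i} * (\<Prod>l\<in>{1..k} - {i}. n l ^ q l)"
proof -
  let ?S = "\<lambda>l. if l = i then {w \<in> W. length w = q i} else {w. set w \<subseteq> {1..n l} \<and> length w = q l}"
  have "{\<beta> \<in> fiber k n i W. \<forall>l\<in>{1..k}. length (\<beta> l) = q l} = (\<Pi>\<^sub>E l\<in>{1..k}. ?S l)"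
  proof (intro equalityI subsetI)
    fix \<beta> assume "\<beta> \<in> {\<beta> \<in> fiber k n i W. \<forall>l\<in>{1..k}. length (\<beta> l) = q l}"
    then show "\<beta> \<in> (\<Pi>\<^sub>E l\<in>{1..k}. ?S l)"
      by (auto simp: fiber_def multiwords_def PiE_iff lists_eq_set extensional_def simp del: atLeastAtMost_iff)
  next
    fix \<beta> assume \<beta>: "\<beta> \<in> (\<Pi>\<^sub>E l\<in>{1..k}. ?S l)"
    then have "\<beta> i \<in> W \<and> length (\<beta> i) = q i" using PiE_mem[OF \<beta> i] by simp
    moreover from this have "set (\<beta> l) \<subseteq> {1..n l} \<and> length (\<beta> l) = q l" if "l \<in> {1..k}" for l
      using PiE_mem[OF \<beta> that] W by (cases "l = i") (auto simp: lists_eq_set simp del: atLeastAtMost_iff)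
    ultimately show "\<beta> \<in> {\<beta> \<in> fiber k n i W. \<forall>l\<in>{1..k}. length (\<beta> l) = q l}"
      using \<beta> by (auto simp: fiber_def multiwords_def PiE_iff lists_eq_set simp del: atLeastAtMost_iff)
  qed
  then have "card {\<beta> \<in> fiber k n i W. \<forall>l\<in>{1..k}. length (\<beta> l) = q l} = (\<Prod>l\<in>{1..k}. card (?S l))"
    by (simp add: card_PiE)
  also have "\<dots> = card (?S i) * (\<Prod>l\<in>{1..k} - {i}. card (?S l))"
    using i by (subst prod.remove[of _ i]) simp_all
  also have "(\<Prod>l\<in>{1..k} - {i}. card (?S l)) = (\<Prod>l\<in>{1..k} - {i}. n l ^ q l)"
    by (intro prod.cong) (auto simp: card_lists_length_eq simp del: atLeastAtMost_iff)
  finally show ?thesis by simp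
qed

text \<open>In the quotient of the traces all coordinates but the \<open>i\<close>-th cancel, so the
  curvature is a simplex average of the density of \<open>W\<close> at length
  \<open>q i\<close>.\<close>

lemma curvature_fiber:
  assumes n: "\<forall>l\<in>{1..k}. n l \<ge> 1" and i: "i \<in> {1..k}"
    and W: "[] \<in> W" "\<And>w. w \<in> W \<Longrightarrow> tl w \<in> W" "W \<subseteq> lists {1..n i}"
    and d: "(\<lambda>q. real (card {w \<in> W. length w = q}) / real (n i) ^ q) \<longlonglongrightarrow> t"
  shows "curvature k n (ell2_supp (fiber k n i W)) (truncated_shift (fiber k n i W)) = complex_of_real t"
proof -
  interpret suffix_closed k n "fiber k n i W" by (rule suffix_closed_fiber[OF W(1,2) i])
  let ?d = "\<lambda>q. real (card {w \<in> W. length w = q}) / real (n i) ^ q"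
  \<comment> \<open>All multiwords form the fiber over all words, so the denominator is counted by
    the same formula.\<close>
  have univ: "multiwords k n = fiber k n i (lists {1..n i})"
    using i by (auto simp: fiber_def multiwords_def)
  have ratio: "of_nat (card {\<beta> \<in> fiber k n i W. \<forall>l\<in>{1..k}. length (\<beta> l) = q l}) /
      of_nat (card {\<beta> \<in> multiwords k n. \<forall>l\<in>{1..k}. length (\<beta> l) = q l}) = complex_of_real (?d (q i))" for q
  proof -
    have "(\<Prod>l\<in>{1..k} - {i}. n l ^ q l) \<noteq> 0" using n by (auto simp: prod_zero_iff)
    moreover have "card {w \<in> lists {1..n i}. length w = q i} = n i ^ q i"
      using card_lists_length_eq[of "{1..n i}" "q i"] by (simp add: lists_eq_set)
    ultimately show ?thesis
      unfolding univ card_fiber_level[of i k W n q, OF i W(3)]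
        card_fiber_level[of i k "lists {1..n i}" n q, OF i order_refl] by simp
  qed
  have "(\<lambda>m. complex_of_real ((\<Sum>q\<in>nat_simplex {1..k} m. ?d (q i)) / real ((m + k) choose k))) \<longlonglongrightarrow> complex_of_real t"
    by (intro tendsto_of_real simplex_average_tendsto d i)
  then show ?thesis
    unfolding curvature_def trace_berezin trace_level_proj ratio nat_simplex_def
    by (intro limI) simp
qed

section \<open>The family indexed by the left endpoint\<close>

theorem theorem3p7:
  fixes k :: nat and n :: "nat \<Rightarrow> nat" and t :: real
  assumes "\<forall>i\<in>{1..k}. n i \<ge> 1"
    and "\<exists>i\<in>{1..k}. \<exists>j\<in>{1..k}. i \<noteq> j \<and> n i \<ge> 2 \<and> n j \<ge> 2"
    and "0 < t" and "t < 1"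
  shows "\<exists>(\<Omega> :: real set) (H :: real \<Rightarrow> (nat \<Rightarrow> nat list, complex) ell2 set)
            (T :: real \<Rightarrow> (nat \<Rightarrow> nat list, complex) ell2 op_tuple).
           uncountable \<Omega> \<and>
           (\<forall>\<omega>\<in>\<Omega>. hilbert_subspace (H \<omega>) \<and> T \<omega> \<in> regular_polyball k n (H \<omega>) \<and>
                    pure_tuple k n (H \<omega>) (T \<omega>)) \<and>
           (\<forall>\<omega>\<in>\<Omega>. \<forall>\<sigma>\<in>\<Omega>. \<omega> \<noteq> \<sigma> \<longrightarrow>
              \<not> unitarily_equivalent k n (H \<omega>) (T \<omega>) (H \<sigma>) (T \<sigma>)) \<and>
           (\<forall>\<omega>\<in>\<Omega>. polyball_rank k n (H \<omega>) (T \<omega>) = 1 \<and>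
                    curvature k n (H \<omega>) (T \<omega>) = complex_of_real t)"
proof -
  obtain i where i: "i \<in> {1..k}" "n i \<ge> 2" using assms(2) by blast
  \<comment> \<open>The interval from \<open>s\<close> to \<open>s + t\<close> has length
    \<open>t\<close>, the required density; \<open>0 < s < 1 - t\<close> keeps it inside the unit
    interval.\<close>
  let ?W = "\<lambda>s. interval_words (n i) s (s + t)"
  let ?A = "\<lambda>s. fiber k n i (?W s)"
  \<comment> \<open>The empty word stands for the whole unit interval: its value is 0 at scale
    1.\<close>
  have Nil: "[] \<in> ?W s" if "s \<in> {0<..<1 - t}" for s
    using that assms(3) by (simp add: interval_words_def)
  have lists: "?W s \<subseteq> lists {1..n i}" for s
    by (auto simp: interval_words_def lists_eq_set)
  have closed: "suffix_closed k n (?A s)" if "s \<in> {0<..<1 - t}" for s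
    by (intro suffix_closed_fiber Nil that interval_words_tl i(1))
  have curv: "curvature k n (ell2_supp (?A s)) (truncated_shift (?A s)) = complex_of_real t"
    if "s \<in> {0<..<1 - t}" for s
  proof (rule curvature_fiber[OF assms(1) i(1) Nil[OF that] interval_words_tl lists])
    show "(\<lambda>q. real (card {w \<in> ?W s. length w = q}) / real (n i) ^ q) \<longlonglongrightarrow> t"
      using interval_words_density[of s "s + t" "n i"] that assms(3) i(2) by simp
  qed
  \<comment> \<open>Failure of one inclusion suffices, since distinct parameters can be
    ordered.\<close>
  have less: "\<not> ?A s \<subseteq> ?A s'" if "s \<in> {0<..<1 - t}" "s < s'" for s s'
    using fiber_subset_imp_subset[of k n i "?W s" "?W s'", OF _ lists i(1)]
      interval_words_separate[of s s' "s + t" "n i" "s' + t"] that assms(3) i(2) by auto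
  have "?A s \<noteq> ?A s'" if "s \<in> {0<..<1 - t}" "s' \<in> {0<..<1 - t}" "s \<noteq> s'" for s s'
    using less[of s s'] less[of s' s] that by (cases "s < s'") auto
  then have ineq: "\<not> unitarily_equivalent k n (ell2_supp (?A s)) (truncated_shift (?A s))
      (ell2_supp (?A s')) (truncated_shift (?A s'))"
    if "s \<in> {0<..<1 - t}" "s' \<in> {0<..<1 - t}" "s \<noteq> s'" for s s'
    using that truncated_shift_unitarily_equivalent_imp_eq[OF closed closed] by blast
  have "uncountable {0<..<1 - t}" using assms(4) by (simp add: uncountable_open_interval)
  then show ?thesis
    by (intro exI[of _ "{0<..<1 - t}"] exI[of _ "\<lambda>s. ell2_supp (?A s)"] exI[of _ "\<lambda>s. truncated_shift (?A s)"]
        conjI ballI impI hilbert_subspace_ell2_supp ineq curv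
        suffix_closed.truncated_shift_regular_polyball[OF closed]
        suffix_closed.pure_truncated_shift[OF closed]
        suffix_closed.polyball_rank_truncated_shift[OF closed])
qed

end
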